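(* Let $\mathbb{F}_q$ be a finite field of characteristic $p\neq 2$, let $a,b\in\mathbb{F}_q$ with $ab(a-b)\neq 0$, and let $E=\tilde{\mathcal{H}}_{a,b}: X(aY^2-Z^2)=Y(bX^2-Z^2)$ be the generalized Huff curve with neutral element $O=(0:0:1)$. Let $r>5$ be a prime with $r\neq p$ and $r\mid \#E(\mathbb{F}_q)$, and suppose the embedding degree $k$ of $E$ with respect to $r$ is even. Let $P=(X_P:Y_P:Z_P)\in E(\mathbb{F}_q)$ be a point of order $r$, and let $Q\in E(\mathbb{F}_{q^k})[r]\setminus E(\mathbb{F}_q)$ be of the form $Q=(1:y_Q:z_Q\alpha)$ with $y_Q,z_Q\in\mathbb{F}_{q^{k/2}}$. Then the addition step of the Miller loop computing the reduced Tate pairing of $P$ and $Q$, that is, the step which from the current projective point $R=(X_R:Y_R:Z_R)\in E(\mathbb{F}_q)$ and the current value $f\in\mathbb{F}_{q^k}$ computes projective coordinates of $R+P$ together with $f\cdot g_{R,P}(Q)$ (the latter up to a factor in $\mathbb{F}_{q^{k/2}}^{*}$), can be performed at cost $$1\mathbf{M}+(k+15)\mathbf{m}+2\mathbf{c}.$$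
   Context: Embedding degree: the smallest positive integer $k$ with $r\mid q^k-1$. The element $\alpha\in\mathbb{F}_{q^k}$ satisfies $\mathbb{F}_{q^k}=\mathbb{F}_{q^{k/2}}(\alpha)$ with $\alpha^2$ a non-square in $\mathbb{F}_{q^{k/2}}$. Group law: on the smooth plane cubic $E$, the point $O=(0:0:1)$ is an inflection point and is the neutral element of the chord-and-tangent law. Functions: for $R_1,R_2\in E(\mathbb{F}_q)$, let $l_{R_1,R_2}$ be the rational function on $E$ obtained by dividing by $X$ a nonzero linear form over $\mathbb{F}_q$ defining the line through $R_1$ and $R_2$ (the tangent line to $E$ at $R_1$ if $R_1=R_2$); it is defined up to a constant in $\mathbb{F}_q^*$. Put $g_{R_1,R_2}=l_{R_1,R_2}/l_{R_1+R_2,O}$. Miller loop: write $r=(r_l,r_{l-1},\dots,r_0)_2$ in binary with $r_l=1$. Start with $R\gets P$, $f\gets 1$. For $i=l-1,\dots,0$: (doubling step) $f\gets f^2\cdot g_{R,R}(Q)$, $R\gets 2R$; then, if $r_i=1$, (addition step) $f\gets f\cdot g_{R,P}(Q)$, $R\gets R+P$. Finally output $f^{(q^k-1)/r}$. Factors lying in $\mathbb{F}_{q^{k/2}}^*$ may be dropped from $f$ at any step, because they become $1$ in the final exponentiation. Cost model: $\mathbf{M}$ is the cost of a multiplication in $\mathbb{F}_{q^k}$; $\mathbf{m}$ is the cost of a multiplication in $\mathbb{F}_q$; $\mathbf{c}$ is the cost of a multiplication of an element of $\mathbb{F}_q$ by one of the curve constants $a$, $b$. Multiplying an element of $\mathbb{F}_q$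 by an element of $\mathbb{F}_{q^{k/2}}$, or by an element of $\mathbb{F}_{q^{k/2}}\cdot\alpha$ (given by $k/2$ coordinates over $\mathbb{F}_q$), costs $\frac{k}{2}\mathbf{m}$. Additions and subtractions (in particular multiplications by small integers such as $2$) are not counted. Quantities depending only on $P$ and $Q$ (not on $R$ or $f$) are precomputed and not counted. "Can be performed at cost $C$" means that there is a sequence of such operations, the same for all occurrences of the step, that computes the required output using at most the number of operations of each kind listed in $C$. *)

theory Defs
  imports
    "HOL-Computational_Algebra.Computational_Algebra"
    "HOL-Library.Multiset"
    "HOL-Library.Product_Plus"
    "HOL-Library.Product_Order"
begin

section \<open>Finite fields\<close>

text \<open>
  The field with \<open>q ^ k\<close> elements is a type \<open>'f\<close>; the fields with \<open>q\<close> and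
  \<open>q ^ (k div 2)\<close> elements are subfields of it, given as sets.
\<close>

definition is_subfield :: "'f::field set \<Rightarrow> bool" where
  "is_subfield K \<longleftrightarrow> 0 \<in> K \<and> 1 \<in> K \<and>
     (\<forall>x\<in>K. \<forall>y\<in>K. x + y \<in> K \<and> x - y \<in> K \<and> x * y \<in> K) \<and>
     (\<forall>x\<in>K. inverse x \<in> K)"

text \<open>\<open>\<alpha>\<close> generates the whole field over \<open>K\<close>, and \<open>\<alpha>\<^sup>2\<close> is a non-square in \<open>K\<close>.\<close>

definition quadratic_generator :: "'f::field set \<Rightarrow> 'f \<Rightarrow> bool" where
  "quadratic_generator K \<alpha> \<longleftrightarrow>
     \<alpha>\<^sup>2 \<in> K \<and> (\<forall>x\<in>K. x\<^sup>2 \<noteq> \<alpha>\<^sup>2) \<and>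
     (\<forall>K'. is_subfield K' \<and> K \<subseteq> K' \<and> \<alpha> \<in> K' \<longrightarrow> K' = UNIV)"

definition is_embedding_degree :: "nat \<Rightarrow> nat \<Rightarrow> nat \<Rightarrow> bool" where
  "is_embedding_degree q r k \<longleftrightarrow>
     0 < k \<and> r dvd q ^ k - 1 \<and> (\<forall>j. 0 < j \<and> j < k \<longrightarrow> \<not> r dvd q ^ j - 1)"


section \<open>The generalized Huff curve\<close>

type_synonym 'f vec3 = "'f \<times> 'f \<times> 'f"

text \<open>A projective point is the set of its coordinate vectors.\<close>

type_synonym 'f point = "'f vec3 set"

definition proj :: "'f::field vec3 \<Rightarrow> 'f point" where
  "proj = (\<lambda>(X, Y, Z). {(c * X, c * Y, c * Z) | c. c \<noteq> 0})"

definition huff_form :: "'r::comm_ring_1 \<Rightarrow> 'r \<Rightarrow> 'r vec3 \<Rightarrow> 'r" where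
  "huff_form a b = (\<lambda>(X, Y, Z). X * (a * Y\<^sup>2 - Z\<^sup>2) - Y * (b * X\<^sup>2 - Z\<^sup>2))"

definition huff_points :: "'f::field set \<Rightarrow> 'f \<Rightarrow> 'f \<Rightarrow> 'f point set" where
  "huff_points K a b = {proj V | V. V \<in> K \<times> K \<times> K \<and> V \<noteq> (0, 0, 0) \<and> huff_form a b V = 0}"

definition huff_O :: "'f::field point" where
  "huff_O = proj (0, 0, 1)"

text \<open>The vector of partial derivatives of \<^const>\<open>huff_form\<close>.\<close>

definition huff_grad :: "'f::field \<Rightarrow> 'f \<Rightarrow> 'f vec3 \<Rightarrow> 'f vec3" where
  "huff_grad a b = (\<lambda>(X, Y, Z).
     (a * Y\<^sup>2 - Z\<^sup>2 - 2 * b * X * Y, 2 * a * X * Y - b * X\<^sup>2 + Z\<^sup>2, 2 * Y * Z - 2 * X * Z))"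


section \<open>Lines and the chord-and-tangent law\<close>

text \<open>A linear form, and with it the line it defines, is given by its coefficient vector.\<close>

definition lin :: "'f::field vec3 \<Rightarrow> 'f vec3 \<Rightarrow> 'f" where
  "lin = (\<lambda>(A, B, C) (X, Y, Z). A * X + B * Y + C * Z)"

definition on_line :: "'f::field vec3 \<Rightarrow> 'f point \<Rightarrow> bool" where
  "on_line l S \<longleftrightarrow> (\<forall>V\<in>S. lin l V = 0)"

definition line_through :: "'f::field \<Rightarrow> 'f \<Rightarrow> 'f point \<Rightarrow> 'f point \<Rightarrow> 'f vec3 \<Rightarrow> bool" where
  "line_through a b R1 R2 l \<longleftrightarrow> l \<noteq> (0, 0, 0) \<and>
     (if R1 = R2 then \<exists>V\<in>R1. l \<in> proj (huff_grad a b V) else on_line l R1 \<and> on_line l R2)"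

text \<open>The form of the curve at \<open>U + t V\<close>, as a polynomial in \<open>t\<close>.\<close>

definition huff_along :: "'f::field \<Rightarrow> 'f \<Rightarrow> 'f vec3 \<Rightarrow> 'f vec3 \<Rightarrow> 'f poly" where
  "huff_along a b = (\<lambda>(X, Y, Z) (X', Y', Z').
     huff_form [:a:] [:b:] ([:X, X':], [:Y, Y':], [:Z, Z':]))"

text \<open>
  \<open>D\<close> is the intersection divisor of the line \<open>l\<close> with the curve: the intersection
  multiplicity at a point \<open>U\<close> of the line is the order of vanishing at \<open>t = 0\<close> of the form
  at \<open>U + t V\<close>, for any second point \<open>V\<close> of the line.
\<close>

definition line_divisor :: "'f::field \<Rightarrow> 'f \<Rightarrow> 'f vec3 \<Rightarrow> 'f point multiset \<Rightarrow> bool" where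
  "line_divisor a b l D \<longleftrightarrow>
     (\<forall>S\<in>#D. on_line l S) \<and>
     (\<forall>U V. U \<noteq> (0, 0, 0) \<and> V \<noteq> (0, 0, 0) \<and> proj U \<noteq> proj V \<and> lin l U = 0 \<and> lin l V = 0 \<longrightarrow>
        huff_along a b U V \<noteq> 0 \<and> order 0 (huff_along a b U V) = count D (proj U))"

definition third_point :: "'f::field \<Rightarrow> 'f \<Rightarrow> 'f point \<Rightarrow> 'f point \<Rightarrow> 'f point" where
  "third_point a b R1 R2 = (THE S. S \<in> huff_points UNIV a b \<and>
     (\<exists>l. line_through a b R1 R2 l \<and> line_divisor a b l {#R1, R2, S#}))"

text \<open>As the neutral element is an inflection point, \<open>-S\<close> is the third point on the line
  through \<open>S\<close> and it.\<close>

definition huff_add :: "'f::field \<Rightarrow> 'f \<Rightarrow> 'f point \<Rightarrow> 'f point \<Rightarrow> 'f point" where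
  "huff_add a b R1 R2 = third_point a b huff_O (third_point a b R1 R2)"

definition huff_smult :: "'f::field \<Rightarrow> 'f \<Rightarrow> nat \<Rightarrow> 'f point \<Rightarrow> 'f point" where
  "huff_smult a b n S = ((huff_add a b S) ^^ n) huff_O"

definition has_order :: "'f::field \<Rightarrow> 'f \<Rightarrow> 'f point \<Rightarrow> nat \<Rightarrow> bool" where
  "has_order a b S n \<longleftrightarrow> 0 < n \<and> huff_smult a b n S = huff_O \<and>
     (\<forall>m. 0 < m \<and> m < n \<longrightarrow> huff_smult a b m S \<noteq> huff_O)"


section \<open>The Miller loop\<close>

text \<open>
  The functions \<open>l\<close> and \<open>g\<close> are only defined up to constants in \<open>K\<close>, so the
  following are the sets of their possible values at \<open>Q\<close>.
\<close>

definition l_values :: "'f::field set \<Rightarrow> 'f \<Rightarrow> 'f \<Rightarrow> 'f point \<Rightarrow> 'f point \<Rightarrow> 'f point \<Rightarrow> 'f set" where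
  "l_values K a b R1 R2 Q =
     {lin l V / fst V | l V. l \<in> K \<times> K \<times> K \<and> line_through a b R1 R2 l \<and> V \<in> Q}"

definition g_values :: "'f::field set \<Rightarrow> 'f \<Rightarrow> 'f \<Rightarrow> 'f point \<Rightarrow> 'f point \<Rightarrow> 'f point \<Rightarrow> 'f set" where
  "g_values K a b R1 R2 Q =
     {u / v | u v. u \<in> l_values K a b R1 R2 Q \<and>
                   v \<in> l_values K a b (huff_add a b R1 R2) huff_O Q}"

text \<open>
  \<open>miller_iter i R f\<close>: the loop may hold the values \<open>R\<close> and \<open>f\<close> when the bits of \<open>r\<close> at
  positions \<open>\<ge> i\<close> have been processed. \<open>miller_doubled i R f\<close>: the same after the doubling
  step for bit \<open>i\<close>; the addition step for bit \<open>i\<close> starts from these values if that bit is 1.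
  The factors \<open>u\<close> account for the elements of \<open>Fh\<close> that may be dropped.
\<close>

inductive miller_iter miller_doubled ::
    "'f::field set \<Rightarrow> 'f set \<Rightarrow> 'f \<Rightarrow> 'f \<Rightarrow> nat \<Rightarrow> 'f point \<Rightarrow> 'f point \<Rightarrow> nat \<Rightarrow> 'f point \<Rightarrow> 'f \<Rightarrow> bool"
  for Fq Fh :: "'f set" and a b :: 'f and r :: nat and P Q :: "'f point"
where
  start: "2 ^ l \<le> r \<Longrightarrow> r < 2 ^ Suc l \<Longrightarrow> miller_iter Fq Fh a b r P Q l P 1"
| double: "miller_iter Fq Fh a b r P Q (Suc i) R f \<Longrightarrow>
     w \<in> g_values Fq a b R R Q \<Longrightarrow> u \<in> Fh - {0} \<Longrightarrow>
     miller_doubled Fq Fh a b r P Q i (huff_add a b R R) (u * (f\<^sup>2 * w))"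
| add: "miller_doubled Fq Fh a b r P Q i R f \<Longrightarrow> bit r i \<Longrightarrow>
     w \<in> g_values Fq a b R P Q \<Longrightarrow> u \<in> Fh - {0} \<Longrightarrow>
     miller_iter Fq Fh a b r P Q i (huff_add a b R P) (u * (f * w))"
| skip: "miller_doubled Fq Fh a b r P Q i R f \<Longrightarrow> \<not> bit r i \<Longrightarrow>
     miller_iter Fq Fh a b r P Q i R f"


section \<open>The cost model\<close>

text \<open>
  A straight-line program acts on a list of registers, each instruction appending its
  result. Every register has a static kind: it holds an element of the field with \<open>q\<close>
  elements, of the one with \<open>q ^ (k div 2)\<close> elements, of \<open>\<alpha>\<close> times the latter, or of the
  field with \<open>q ^ k\<close> elements.
\<close>

datatype kind = Base | Half | Half_alpha | Full

fun kind_set :: "'f::field set \<Rightarrow> 'f set \<Rightarrow> 'f \<Rightarrow> kind \<Rightarrow> 'f set" where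
  "kind_set Fq Fh \<alpha> Base = Fq"
| "kind_set Fq Fh \<alpha> Half = Fh"
| "kind_set Fq Fh \<alpha> Half_alpha = {x * \<alpha> | x. x \<in> Fh}"
| "kind_set Fq Fh \<alpha> Full = UNIV"

text \<open>\<open>Mul_a\<close> and \<open>Mul_b\<close> multiply by the curve constants.\<close>

datatype instr = Add nat nat | Sub nat nat | Mul nat nat | Mul_a nat | Mul_b nat

fun sum_kind :: "kind \<Rightarrow> kind \<Rightarrow> kind" where
  "sum_kind s t =
     (if s = t then s else if {s, t} = {Base, Half} then Half else Full)"

text \<open>A cost \<open>(n\<^sub>M, n\<^sub>m, n\<^sub>c)\<close> counts the operations \<open>M\<close>, \<open>m\<close> and \<open>c\<close>; costs are added and
  compared componentwise.\<close>

type_synonym cost = "nat \<times> nat \<times> nat"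

text \<open>Products that the cost model does not list separately are multiplications in the
  field with \<open>q ^ k\<close> elements.\<close>

fun mul_kind :: "kind \<Rightarrow> kind \<Rightarrow> kind" where
  "mul_kind Base Base = Base"
| "mul_kind Base Half = Half"
| "mul_kind Half Base = Half"
| "mul_kind Base Half_alpha = Half_alpha"
| "mul_kind Half_alpha Base = Half_alpha"
| "mul_kind _ _ = Full"

fun mul_cost :: "nat \<Rightarrow> kind \<Rightarrow> kind \<Rightarrow> cost" where
  "mul_cost k s t =
     (case mul_kind s t of
        Base \<Rightarrow> (0, 1, 0)
      | Half \<Rightarrow> (0, k div 2, 0)
      | Half_alpha \<Rightarrow> (0, k div 2, 0)
      | Full \<Rightarrow> (1, 0, 0))"

fun instr_ok :: "kind list \<Rightarrow> instr \<Rightarrow> bool" where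
  "instr_ok ks (Add i j) \<longleftrightarrow> i < length ks \<and> j < length ks"
| "instr_ok ks (Sub i j) \<longleftrightarrow> i < length ks \<and> j < length ks"
| "instr_ok ks (Mul i j) \<longleftrightarrow> i < length ks \<and> j < length ks"
| "instr_ok ks (Mul_a i) \<longleftrightarrow> i < length ks \<and> ks ! i = Base"
| "instr_ok ks (Mul_b i) \<longleftrightarrow> i < length ks \<and> ks ! i = Base"

fun instr_kind :: "kind list \<Rightarrow> instr \<Rightarrow> kind" where
  "instr_kind ks (Add i j) = sum_kind (ks ! i) (ks ! j)"
| "instr_kind ks (Sub i j) = sum_kind (ks ! i) (ks ! j)"
| "instr_kind ks (Mul i j) = mul_kind (ks ! i) (ks ! j)"
| "instr_kind ks (Mul_a i) = Base"
| "instr_kind ks (Mul_b i) = Base"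

fun instr_cost :: "nat \<Rightarrow> kind list \<Rightarrow> instr \<Rightarrow> cost" where
  "instr_cost k ks (Add i j) = (0, 0, 0)"
| "instr_cost k ks (Sub i j) = (0, 0, 0)"
| "instr_cost k ks (Mul i j) = mul_cost k (ks ! i) (ks ! j)"
| "instr_cost k ks (Mul_a i) = (0, 0, 1)"
| "instr_cost k ks (Mul_b i) = (0, 0, 1)"

fun instr_val :: "'f::field \<Rightarrow> 'f \<Rightarrow> 'f list \<Rightarrow> instr \<Rightarrow> 'f" where
  "instr_val a b vs (Add i j) = vs ! i + vs ! j"
| "instr_val a b vs (Sub i j) = vs ! i - vs ! j"
| "instr_val a b vs (Mul i j) = vs ! i * vs ! j"
| "instr_val a b vs (Mul_a i) = a * vs ! i"
| "instr_val a b vs (Mul_b i) = b * vs ! i"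

fun prog_ok :: "kind list \<Rightarrow> instr list \<Rightarrow> bool" where
  "prog_ok ks [] \<longleftrightarrow> True"
| "prog_ok ks (x # xs) \<longleftrightarrow> instr_ok ks x \<and> prog_ok (ks @ [instr_kind ks x]) xs"

fun prog_cost :: "nat \<Rightarrow> kind list \<Rightarrow> instr list \<Rightarrow> cost" where
  "prog_cost k ks [] = (0, 0, 0)"
| "prog_cost k ks (x # xs) = instr_cost k ks x + prog_cost k (ks @ [instr_kind ks x]) xs"

fun exec :: "'f::field \<Rightarrow> 'f \<Rightarrow> 'f list \<Rightarrow> instr list \<Rightarrow> 'f list" where
  "exec a b vs [] = vs"
| "exec a b vs (x # xs) = exec a b (vs @ [instr_val a b vs x]) xs"

end

theory Submission
  imports Defs
begin

text \<open>
  Scale \<open>P\<close> to \<open>(p : q : 1)\<close> and write \<open>R = Z P + (p u, q v, 0)\<close>. On the line through \<open>P\<close> and \<open>R\<close> the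
  equation of the curve is a binary cubic with two known zeros; its third zero is \<open>-(R + P)\<close>,
  which gives formulas for \<open>R + P\<close> with the single exception \<open>R = P\<close>. The coefficients of the line are
  \<open>v, -(p / q) u, p (u - v)\<close>, so that its value at \<open>Q\<close> costs only \<open>k m\<close>. The denominator of
  \<open>g\<close> at \<open>Q\<close> lies in the half field and does not vanish, because otherwise \<open>Q\<close> would be rational.

  In the loop \<open>R = (2 m) P\<close> with \<open>2 m < r\<close>, hence \<open>R \<noteq> P\<close>, provided that doubling \<open>m P\<close> gives
  \<open>(2 m) P\<close>. Full associativity is not needed for this: the identity
  \<open>2 A + (B - A) = A + B\<close>, a computation with the slopes of four lines, is enough.
\<close>

section \<open>Closure properties of subfields\<close>

lemma subfield_closed:
  assumes "is_subfield K"
  shows "x \<in> K \<Longrightarrow> y \<in> K \<Longrightarrow> x + y \<in> K" "x \<in> K \<Longrightarrow> y \<in> K \<Longrightarrow> x - y \<in> K"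
    "x \<in> K \<Longrightarrow> y \<in> K \<Longrightarrow> x * y \<in> K" "x \<in> K \<Longrightarrow> y \<in> K \<Longrightarrow> x / y \<in> K"
    "x \<in> K \<Longrightarrow> - x \<in> K" "x \<in> K \<Longrightarrow> x\<^sup>2 \<in> K" "0 \<in> K" "1 \<in> K"
proof -
  have K: "\<forall>x\<in>K. \<forall>y\<in>K. x + y \<in> K \<and> x - y \<in> K \<and> x * y \<in> K" "\<forall>x\<in>K. inverse x \<in> K"
    and 01: "0 \<in> K" "1 \<in> K"
    using assms unfolding is_subfield_def by blast+
  show "x + y \<in> K" "x - y \<in> K" "x * y \<in> K" "x / y \<in> K" if "x \<in> K" "y \<in> K"
    using K that unfolding divide_inverse by blast+
  show "x\<^sup>2 \<in> K" "- x \<in> K" if "x \<in> K"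
    using K(1) 01 that unfolding power2_eq_square diff_0[symmetric] by blast+
  show "0 \<in> K" "1 \<in> K"
    by (fact 01)+
qed

section \<open>Lines and intersection divisors\<close>

lemma proj_refl: "V \<in> proj V"
  by (cases V) (auto simp: proj_def intro: exI[of _ 1])

lemma proj_scale:
  assumes "c \<noteq> 0"
  shows "proj (c * X, c * Y, c * Z) = proj (X, Y, Z)"
proof -
  have "\<exists>d'. d * X = d' * (c * X) \<and> d * Y = d' * (c * Y) \<and> d * Z = d' * (c * Z) \<and> d' \<noteq> 0"
    if "d \<noteq> 0" for d
    using assms that by (intro exI[of _ "d / c"]) auto
  moreover have "\<exists>d'. d * (c * X) = d' * X \<and> d * (c * Y) = d' * Y \<and> d * (c * Z) = d' * Z \<and> d' \<noteq> 0"
    if "d \<noteq> 0" for d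
    using assms that by (intro exI[of _ "d * c"]) auto
  ultimately show ?thesis
    by (fastforce simp: proj_def)
qed

lemma proj_eqD:
  assumes "proj (X, Y, Z) = proj (X', Y', Z')"
  obtains c where "c \<noteq> 0" "X' = c * X" "Y' = c * Y" "Z' = c * Z"
proof -
  have "(X', Y', Z') \<in> proj (X, Y, Z)"
    unfolding assms by (rule proj_refl)
  then show thesis
    using that by (auto simp: proj_def)
qed

lemma proj_eq_iff:
  assumes "(X, Y, Z) \<noteq> (0, 0, 0)" "(X', Y', Z') \<noteq> (0, 0, 0)"
  shows "proj (X, Y, Z) = proj (X', Y', Z') \<longleftrightarrow>
    X * Y' = X' * Y \<and> X * Z' = X' * Z \<and> Y * Z' = Y' * Z"
proof
  assume "proj (X, Y, Z) = proj (X', Y', Z')"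
  then show "X * Y' = X' * Y \<and> X * Z' = X' * Z \<and> Y * Z' = Y' * Z"
    by (elim proj_eqD) auto
next
  assume *: "X * Y' = X' * Y \<and> X * Z' = X' * Z \<and> Y * Z' = Y' * Z"
  have "\<exists>c. c \<noteq> 0 \<and> X' = c * X \<and> Y' = c * Y \<and> Z' = c * Z"
  proof (cases "X = 0")
    case False
    with * assms show ?thesis
      by (intro exI[of _ "X' / X"]) (auto simp: field_simps)
  next
    case X: True
    show ?thesis
    proof (cases "Y = 0")
      case False
      with X * assms show ?thesis
        by (intro exI[of _ "Y' / Y"]) (auto simp: field_simps)
    next
      case True
      with X * assms show ?thesis
        by (intro exI[of _ "Z' / Z"]) (auto simp: field_simps)
    qed
  qed
  then show "proj (X, Y, Z) = proj (X', Y', Z')"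
    by (auto simp: proj_scale)
qed

lemma lin_zero_proj:
  assumes "proj l = proj l'"
  shows "lin l V = 0 \<longleftrightarrow> lin l' V = 0"
proof -
  obtain A B C A' B' C' X Y Z where *: "l = (A, B, C)" "l' = (A', B', C')" "V = (X, Y, Z)"
    by (metis prod_cases3)
  obtain c where "c \<noteq> 0" "A' = c * A" "B' = c * B" "C' = c * C"
    using assms unfolding * by (rule proj_eqD)
  moreover have "c * A * X + c * B * Y + c * C * Z = c * (A * X + B * Y + C * Z)"
    by (simp add: algebra_simps)
  ultimately show ?thesis
    by (simp add: * lin_def)
qed

lemma on_line_proj: "on_line l (proj V) \<longleftrightarrow> lin l V = 0"
proof -
  obtain A B C X Y Z where *: "l = (A, B, C)" "V = (X, Y, Z)"
    by (metis prod_cases3)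
  have "A * (c * X) + B * (c * Y) + C * (c * Z) = c * (A * X + B * Y + C * Z)" for c
    by (simp add: algebra_simps)
  moreover have "lin l V = 0" if "on_line l (proj V)"
    using that proj_refl[of V] by (auto simp: on_line_def)
  ultimately show ?thesis
    by (auto simp: on_line_def proj_def lin_def *)
qed

text \<open>The coefficients of \<open>l\<close> are orthogonal to both vectors, hence proportional
  to their cross product.\<close>

lemma proj_line_eq_cross:
  assumes "l \<noteq> (0, 0, 0)" "(X, Y, Z) \<noteq> (0, 0, 0)" "(X', Y', Z') \<noteq> (0, 0, 0)"
    and "proj (X, Y, Z) \<noteq> proj (X', Y', Z')" "lin l (X, Y, Z) = 0" "lin l (X', Y', Z') = 0"
  shows "(Y * Z' - Z * Y', Z * X' - X * Z', X * Y' - Y * X') \<noteq> (0, 0, 0)" (is "?N \<noteq> _")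
    and "proj l = proj (Y * Z' - Z * Y', Z * X' - X * Z', X * Y' - Y * X')"
proof -
  show N: "?N \<noteq> (0, 0, 0)"
    using assms by (auto simp: proj_eq_iff mult.commute)
  obtain A B C where l: "l = (A, B, C)"
    by (metis prod_cases3)
  have *: "A * X + B * Y + C * Z = 0" "A * X' + B * Y' + C * Z' = 0"
    using assms by (auto simp: l lin_def)
  have "A * (Z * X' - X * Z') = (Y * Z' - Z * Y') * B"
       "A * (X * Y' - Y * X') = (Y * Z' - Z * Y') * C"
       "B * (X * Y' - Y * X') = (Z * X' - X * Z') * C"
    using * by algebra+
  then show "proj l = proj ?N"
    using assms(1) N unfolding l by (subst proj_eq_iff) auto
qed

lemma line_unique:
  assumes "l \<noteq> (0, 0, 0)" "l' \<noteq> (0, 0, 0)" "U \<noteq> (0, 0, 0)" "V \<noteq> (0, 0, 0)" "proj U \<noteq> proj V"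
    and "lin l U = 0" "lin l V = 0" "lin l' U = 0" "lin l' V = 0"
  shows "proj l = proj l'"
  using assms by (cases U; cases V) (metis proj_line_eq_cross(2))

text \<open>Cramer's rule, with a nonzero entry of the cross product as determinant.\<close>

lemma line_span:
  assumes "l \<noteq> (0, 0, 0)" "(X, Y, Z) \<noteq> (0, 0, 0)" "(X', Y', Z') \<noteq> (0, 0, 0)"
    and "proj (X, Y, Z) \<noteq> proj (X', Y', Z')" "lin l (X, Y, Z) = 0" "lin l (X', Y', Z') = 0"
    and "lin l U = 0"
  obtains u v where "U = (X * u + X' * v, Y * u + Y' * v, Z * u + Z' * v)"
proof -
  obtain x y z where U: "U = (x, y, z)"
    by (metis prod_cases3)
  define A B C where "A = Y * Z' - Z * Y'" "B = Z * X' - X * Z'" "C = X * Y' - Y * X'"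
  have N: "(A, B, C) \<noteq> (0, 0, 0)" and "proj l = proj (A, B, C)"
    using proj_line_eq_cross[OF assms(1-6)] by (simp_all add: A_B_C_def)
  then have *: "A * x + B * y + C * z = 0"
    using lin_zero_proj[of l "(A, B, C)" U] assms(7) by (simp add: U lin_def)
  have divide: "x = X * (u / d) + X' * (v / d)" if "d \<noteq> 0" "d * x = X * u + X' * v" for d x X X' u v :: 'a
    using that by (simp add: field_simps)
  consider "A \<noteq> 0" | "B \<noteq> 0" | "C \<noteq> 0"
    using N by auto
  then have "\<exists>u v. x = X * u + X' * v \<and> y = Y * u + Y' * v \<and> z = Z * u + Z' * v"
  proof cases
    case 1
    have "A * x = X * (y * Z' - z * Y') + X' * (Y * z - Z * y)"
      "A * y = Y * (y * Z' - z * Y') + Y' * (Y * z - Z * y)"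
      "A * z = Z * (y * Z' - z * Y') + Z' * (Y * z - Z * y)"
      using * unfolding A_B_C_def by (simp add: algebra_simps | algebra)+
    then show ?thesis
      using divide[OF 1] by blast
  next
    case 2
    have "B * x = X * (z * X' - x * Z') + X' * (Z * x - X * z)"
      "B * y = Y * (z * X' - x * Z') + Y' * (Z * x - X * z)"
      "B * z = Z * (z * X' - x * Z') + Z' * (Z * x - X * z)"
      using * unfolding A_B_C_def by (simp add: algebra_simps | algebra)+
    then show ?thesis
      using divide[OF 2] by blast
  next
    case 3
    have "C * x = X * (x * Y' - y * X') + X' * (X * y - Y * x)"
      "C * y = Y * (x * Y' - y * X') + Y' * (X * y - Y * x)"
      "C * z = Z * (x * Y' - y * X') + Z' * (X * y - Y * x)"
      using * unfolding A_B_C_def by (simp add: algebra_simps | algebra)+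
    then show ?thesis
      using divide[OF 3] by blast
  qed
  then show thesis
    using that by (auto simp: U)
qed

text \<open>Multiplicities are measured along a second point of the line. Of two different points of
  the line, at least one differs from \<open>U\<close>.\<close>

lemma line_second_point:
  assumes "l \<noteq> (0, 0, 0)"
  obtains V where "V \<noteq> (0, 0, 0)" "lin l V = 0" "proj U \<noteq> proj V"
proof -
  obtain A B C where l: "l = (A, B, C)"
    by (metis prod_cases3)
  have "\<exists>V W. V \<noteq> (0, 0, 0) \<and> W \<noteq> (0, 0, 0) \<and> lin l V = 0 \<and> lin l W = 0 \<and> proj V \<noteq> proj W"
  proof (cases "A = 0")
    case False
    then show ?thesis
      by (intro exI[of _ "(B, - A, 0)"] exI[of _ "(C, 0, - A)"])
        (auto simp: l lin_def proj_eq_iff)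
  next
    case A: True
    show ?thesis
    proof (cases "B = 0")
      case False
      with A show ?thesis
        by (intro exI[of _ "(1, 0, 0)"] exI[of _ "(0, C, - B)"])
          (auto simp: l lin_def proj_eq_iff)
    next
      case True
      with A show ?thesis
        by (intro exI[of _ "(1, 0, 0)"] exI[of _ "(0, 1, 0)"])
          (auto simp: l lin_def proj_eq_iff)
    qed
  qed
  then show thesis
    using that by metis
qed

section \<open>The cubic form restricted to a line\<close>

lemma order_0_linear:
  fixes x y :: "'a::field"
  assumes "[:x, y:] \<noteq> 0"
  shows "order 0 [:x, y:] = (if x = 0 then 1 else 0)"
proof (cases "x = 0")
  case True
  then have "[:x, y:] = smult y ([:- 0, 1:] ^ 1)" "y \<noteq> 0"
    using assms by auto
  then show ?thesis
    using True by (metis order_power_n_n order_smult)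
next
  case False
  then show ?thesis
    by (simp add: order_0I)
qed

text \<open>Polarization of a ternary cubic, without division by 2 or 3. As \<open>u\<close> and
  \<open>v\<close> are polynomials, it applies to \<open>U + x V\<close> once both points are
  expressed in a basis of the line.\<close>

lemma huff_form_combination:
  fixes u v :: "'f::field poly"
  shows "huff_form [:a:] [:b:] (smult X u + smult X' v, smult Y u + smult Y' v, smult Z u + smult Z' v) =
    smult (huff_form a b (X, Y, Z)) (u ^ 3) +
    smult (lin (huff_grad a b (X, Y, Z)) (X', Y', Z')) (u ^ 2 * v) +
    smult (lin (huff_grad a b (X', Y', Z')) (X, Y, Z)) (u * v ^ 2) +
    smult (huff_form a b (X', Y', Z')) (v ^ 3)"
proof -
  have *: "smult c p = [:c:] * p" for c and p :: "'f poly"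
    by simp
  have 1: "x * (A * y\<^sup>2 - z\<^sup>2) - y * (B * x\<^sup>2 - z\<^sup>2) = 
    (X * (A * Y\<^sup>2 - Z\<^sup>2) - Y * (B * X\<^sup>2 - Z\<^sup>2)) * u ^ 3 +
    ((A * Y\<^sup>2 - Z\<^sup>2 - 2 * B * X * Y) * X' + (2 * A * X * Y - B * X\<^sup>2 + Z\<^sup>2) * Y' + (2 * Y * Z - 2 * X * Z) * Z') * (u ^ 2 * v) +
    ((A * Y'\<^sup>2 - Z'\<^sup>2 - 2 * B * X' * Y') * X + (2 * A * X' * Y' - B * X'\<^sup>2 + Z'\<^sup>2) * Y + (2 * Y' * Z' - 2 * X' * Z') * Z) * (u * v ^ 2) +
    (X' * (A * Y'\<^sup>2 - Z'\<^sup>2) - Y' * (B * X'\<^sup>2 - Z'\<^sup>2)) * v ^ 3"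
    if "x = X * u + X' * v" "y = Y * u + Y' * v" "z = Z * u + Z' * v"
    for x y z A B X Y Z X' Y' Z' :: "'f poly"
    unfolding that by algebra
  have 2: "[:x:] * [:y:] = [:x * y:]" "[:x:] + [:y:] = [:x + y:]" "[:x:] - [:y:] = [:x - y:]"
      "[:x:]\<^sup>2 = [:x\<^sup>2:]" "2 * [:x:] = [:2 * x:]" for x y :: 'f
    by (simp_all add: power2_eq_square numeral_poly)
  show ?thesis
    unfolding huff_form_def huff_grad_def lin_def prod.case
    by (simp only: * 1[of "_" "[:X:]" "[:X':]" _ "[:Y:]" "[:Y':]" _ "[:Z:]" "[:Z':]", OF refl refl refl] 2)
qed

text \<open>In coordinates \<open>(s, t)\<close> for the two given points, the coefficient equations
  split the form into factors \<open>m s + n t\<close> with zero \<open>(n, - m)\<close>. Along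
  \<open>U + x V\<close> such a factor is linear in \<open>x\<close> and vanishes at 0 exactly if
  \<open>U\<close> is its zero; orders of products add up.\<close>

lemma line_divisor_of_factors:
  assumes l: "l \<noteq> (0, 0, 0)" and e: "(X, Y, Z) \<noteq> (0, 0, 0)" "(X', Y', Z') \<noteq> (0, 0, 0)"
      "proj (X, Y, Z) \<noteq> proj (X', Y', Z')" "lin l (X, Y, Z) = 0" "lin l (X', Y', Z') = 0"
    and nz: "(m1, n1) \<noteq> (0, 0)" "(m2, n2) \<noteq> (0, 0)" "(m3, n3) \<noteq> (0, 0)"
    and c30: "huff_form a b (X, Y, Z) = m1 * m2 * m3"
    and c21: "lin (huff_grad a b (X, Y, Z)) (X', Y', Z') = m1 * m2 * n3 + m1 * n2 * m3 + n1 * m2 * m3"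
    and c12: "lin (huff_grad a b (X', Y', Z')) (X, Y, Z) = m1 * n2 * n3 + n1 * m2 * n3 + n1 * n2 * m3"
    and c03: "huff_form a b (X', Y', Z') = n1 * n2 * n3"
  defines "S \<equiv> \<lambda>m n. proj (n * X - m * X', n * Y - m * Y', n * Z - m * Z')"
  shows "line_divisor a b l {#S m1 n1, S m2 n2, S m3 n3#}"
proof -
  obtain A B C where l': "l = (A, B, C)"
    by (metis prod_cases3)
  have e0: "A * X + B * Y + C * Z = 0" "A * X' + B * Y' + C * Z' = 0"
    using e by (auto simp: l' lin_def)
  have "on_line l (S m n)" for m n
    using e0 unfolding S_def on_line_proj by (simp add: l' lin_def) algebra
  moreover have "huff_along a b U V \<noteq> 0 \<and>
      order 0 (huff_along a b U V) = count {#S m1 n1, S m2 n2, S m3 n3#} (proj U)"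
    if UV: "U \<noteq> (0, 0, 0)" "V \<noteq> (0, 0, 0)" "proj U \<noteq> proj V" "lin l U = 0" "lin l V = 0" for U V
  proof -
    obtain u u' where U: "U = (X * u + X' * u', Y * u + Y' * u', Z * u + Z' * u')"
      using line_span[OF l e UV(4)] .
    obtain v v' where V: "V = (X * v + X' * v', Y * v + Y' * v', Z * v + Z' * v')"
      using line_span[OF l e UV(5)] .
    \<comment> \<open>The factor \<open>m s + n t\<close> at \<open>U + x V\<close>, whose
      coordinates are \<open>(u + x v, u' + x v')\<close>.\<close>
    define L where "L m n = [:m * u + n * u', m * v + n * v':]" for m n
    have L: "L m n = smult m [:u, v:] + smult n [:u', v':]" for m n
      by (simp add: L_def)
    have det: "u * v' - u' * v \<noteq> 0"
    proof
      assume "u * v' - u' * v = 0"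
      moreover have "(X * u + X' * u') * (Y * v + Y' * v') - (X * v + X' * v') * (Y * u + Y' * u')
          = (X * Y' - X' * Y) * (u * v' - u' * v)"
        "(X * u + X' * u') * (Z * v + Z' * v') - (X * v + X' * v') * (Z * u + Z' * u')
          = (X * Z' - X' * Z) * (u * v' - u' * v)"
        "(Y * u + Y' * u') * (Z * v + Z' * v') - (Y * v + Y' * v') * (Z * u + Z' * u')
          = (Y * Z' - Y' * Z) * (u * v' - u' * v)"
        by algebra+
      ultimately have "proj U = proj V"
        using UV(1,2) unfolding U V by (subst proj_eq_iff) auto
      with UV(3) show False ..
    qed
    have along: "huff_along a b U V = L m1 n1 * L m2 n2 * L m3 n3"
    proof -
      have "huff_along a b U V =
          huff_form [:a:] [:b:] (smult X [:u, v:] + smult X' [:u', v':], 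
            smult Y [:u, v:] + smult Y' [:u', v':], smult Z [:u, v:] + smult Z' [:u', v':])"
        by (simp add: huff_along_def U V)
      also have "\<dots> = L m1 n1 * L m2 n2 * L m3 n3"
        unfolding huff_form_combination c30 c21 c12 c03 L
        by (simp add: power2_eq_square power3_eq_cube algebra_simps smult_add_left smult_add_right)
      finally show ?thesis .
    qed
    have Lnz: "L m n \<noteq> 0" if "(m, n) \<noteq> (0, 0)" for m n
    proof
      assume "L m n = 0"
      then have "m * u + n * u' = 0" "m * v + n * v' = 0"
        by (auto simp: L_def)
      then have "m * (u * v' - u' * v) = 0" "n * (u * v' - u' * v) = 0"
        by algebra+
      with det that show False by auto
    qed
    have ord: "order 0 (L m n) = (if S m n = proj U then 1 else 0)" if mn: "(m, n) \<noteq> (0, 0)" for m n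
    proof -
      have "(n * X - m * X', n * Y - m * Y', n * Z - m * Z') \<noteq> (0, 0, 0)"
      proof
        assume "(n * X - m * X', n * Y - m * Y', n * Z - m * Z') = (0, 0, 0)"
        then have *: "n * X - m * X' = 0" "n * Y - m * Y' = 0" "n * Z - m * Z' = 0"
          by auto
        then have "n * (X * Y' - X' * Y) = 0" "m * (X * Y' - X' * Y) = 0"
          "n * (X * Z' - X' * Z) = 0" "m * (X * Z' - X' * Z) = 0"
          "n * (Y * Z' - Y' * Z) = 0" "m * (Y * Z' - Y' * Z) = 0"
          by algebra+
        then show False
          using mn e(1-3) by (auto simp: proj_eq_iff)
      qed
      \<comment> \<open>Each minor of \<open>U\<close> and the zero of the factor is
        \<open>m u + n u'\<close> times the corresponding minor of the two basis vectors.\<close>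
      then have "S m n = proj U \<longleftrightarrow> 
         (m * u + n * u') * (X * Y' - X' * Y) = 0 \<and> (m * u + n * u') * (X * Z' - X' * Z) = 0 \<and>
         (m * u + n * u') * (Y * Z' - Y' * Z) = 0"
        using UV(1) unfolding S_def U 
        by (subst proj_eq_iff) (simp_all add: algebra_simps)
      also have "\<dots> \<longleftrightarrow> m * u + n * u' = 0"
        using e(1-3) by (auto simp: proj_eq_iff)
      finally show ?thesis
        using Lnz[OF mn] unfolding L_def by (simp add: order_0_linear)
    qed
    show ?thesis
      unfolding along using nz by (auto simp: order_mult Lnz ord)
  qed
  ultimately show ?thesis
    by (auto simp: line_divisor_def)
qed

section \<open>Tangents and uniqueness of intersection divisors\<close>

lemma huff_grad_scale: "proj (huff_grad a b (c * X, c * Y, c * Z)) = proj (huff_grad a b (X, Y, Z))"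
  if "c \<noteq> 0"
proof -
  have "huff_grad a b (c * X, c * Y, c * Z) = (c\<^sup>2 * (a * Y\<^sup>2 - Z\<^sup>2 - 2 * b * X * Y),
    c\<^sup>2 * (2 * a * X * Y - b * X\<^sup>2 + Z\<^sup>2), c\<^sup>2 * (2 * Y * Z - 2 * X * Z))"
    by (simp add: huff_grad_def algebra_simps power2_eq_square)
  with that show ?thesis
    by (simp add: huff_grad_def proj_scale)
qed

lemma line_through_tangent:
  "line_through a b (proj V) (proj V) l \<longleftrightarrow> l \<noteq> (0, 0, 0) \<and> l \<in> proj (huff_grad a b V)"
proof -
  have "proj (huff_grad a b W) = proj (huff_grad a b V)" if W: "W \<in> proj V" for W
  proof -
    obtain X Y Z c where "V = (X, Y, Z)" "W = (c * X, c * Y, c * Z)" "c \<noteq> 0"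
      using W by (cases V) (auto simp: proj_def)
    then show ?thesis
      by (simp add: huff_grad_scale)
  qed
  then have "(\<exists>W\<in>proj V. l \<in> proj (huff_grad a b W)) \<longleftrightarrow> l \<in> proj (huff_grad a b V)"
    using proj_refl[of V] by metis
  then show ?thesis
    by (simp add: line_through_def)
qed

lemma mem_proj_iff: "l \<noteq> (0, 0, 0) \<Longrightarrow> l \<in> proj l' \<longleftrightarrow> proj l = proj l'"
proof
  assume "l \<noteq> (0, 0, 0)" "l \<in> proj l'"
  then obtain X Y Z c where "l' = (X, Y, Z)" "l = (c * X, c * Y, c * Z)" "c \<noteq> 0"
    by (cases l') (auto simp: proj_def)
  then show "proj l = proj l'"
    by (simp add: proj_scale)
qed (metis proj_refl)

lemma huff_pointsE:
  assumes "S \<in> huff_points UNIV a b"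
  obtains X Y Z where "S = proj (X, Y, Z)" "(X, Y, Z) \<noteq> (0, 0, 0)" "huff_form a b (X, Y, Z) = 0"
  using assms by (auto simp: huff_points_def)

lemma line_divisor_proj_cong:
  assumes "proj l = proj l'"
  shows "line_divisor a b l D \<longleftrightarrow> line_divisor a b l' D"
proof -
  have "lin l V = 0 \<longleftrightarrow> lin l' V = 0" for V
    using assms by (rule lin_zero_proj)
  then show ?thesis
    by (simp add: line_divisor_def on_line_def)
qed

text \<open>Every multiplicity is determined by the line. Lying on the curve makes the elements of
  \<open>D\<close> and \<open>D'\<close> genuine projective points, and \<open>line_divisor\<close>
  fixes the counts of these.\<close>

lemma line_divisor_unique:
  assumes "line_divisor a b l D" "line_divisor a b l' D'" "proj l = proj l'" "l \<noteq> (0, 0, 0)"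
    and "set_mset D \<subseteq> huff_points UNIV a b" "set_mset D' \<subseteq> huff_points UNIV a b"
  shows "D = D'"
proof -
  have *: "line_divisor a b l D'"
    using assms line_divisor_proj_cong by metis
  have "count D S = count D' S" if S: "S \<in># D + D'" for S
  proof -
    obtain X Y Z where U: "S = proj (X, Y, Z)" "(X, Y, Z) \<noteq> (0, 0, 0)"
      using assms(5,6) S by (metis huff_pointsE subsetD union_iff)
    have "lin l (X, Y, Z) = 0"
      using S U assms(1) * by (auto simp: line_divisor_def on_line_proj[symmetric])
    moreover obtain V where "V \<noteq> (0, 0, 0)" "lin l V = 0" "proj (X, Y, Z) \<noteq> proj V"
      using line_second_point[OF assms(4)] by metis
    ultimately show ?thesis
      using U assms(1) * unfolding line_divisor_def by metis
  qed
  then show ?thesis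
    by (metis multiset_eqI count_eq_zero_iff union_iff)
qed

section \<open>The straight-line program\<close>

text \<open>Seven coefficients computed from \<open>P\<close> and the curve constants, the affine
  coordinates of \<open>P\<close>, and two products of coefficients with the coordinates of
  \<open>Q\<close>.\<close>

definition addition_kinds :: "kind list" where
  "addition_kinds = [Base, Base, Base, Base, Base, Base, Base, Base, Base, Half, Half_alpha]"

text \<open>
  Registers 0 to 3 hold \<open>X, Y, Z, f\<close> and 4 to 14 the precomputed values. Then 16 is \<open>u\<close>, 18 is \<open>v\<close>,
  21 is \<open>G\<close>, 28 is \<open>H\<close>, 30 is \<open>J\<close> and 41 the value at \<open>Q\<close> of the line, in the notation of
  \<open>addition_formula\<close> below; the scaling of \<open>u\<close> and \<open>v\<close> makes the coefficients of the line free.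
\<close>

definition addition_prog :: "instr list" where
  "addition_prog =
    [Mul 0 4, Sub 15 2, Mul 1 5, Sub 17 2,
     Mul 6 16, Mul 7 18, Add 19 20,
     Mul 8 18, Mul 9 16, Add 22 23, Mul 24 18, Mul 10 16, Mul 26 16, Add 25 27,
     Mul 21 2, Add 28 29,
     Mul 21 16, Sub 31 30, Mul 32 11,
     Mul 21 18, Sub 34 30, Mul 35 12,
     Mul 13 16, Add 37 18, Sub 16 18, Mul 14 39, Add 38 40, Mul 3 41]"

lemma addition_prog_ok: "prog_ok ([Base, Base, Base, Full] @ addition_kinds) addition_prog"
  by (simp add: addition_prog_def addition_kinds_def)

text \<open>Fourteen products lie in the base field, the two involving \<open>Q\<close> cost
  \<open>k div 2\<close> each, and only the product with \<open>f\<close> is a full one. The curve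
  constants are contained in the precomputed values.\<close>

lemma addition_prog_cost:
  assumes "even k"
  shows "prog_cost k ([Base, Base, Base, Full] @ addition_kinds) addition_prog = (1, k + 14, 0)"
proof -
  have "{Half, Base} = {Base, Half}"
    by auto
  moreover have "k div 2 + k div 2 = k"
    using assms by auto
  ultimately show ?thesis
    by (simp add: addition_prog_def addition_kinds_def)
qed

lemma exec_addition_prog:
  fixes a b X Y Z f c1 c2 c3 c4 c5 c6 c7 p q d e :: "'f::field"
  defines "pre \<equiv> [c1, c2, c3, c4, c5, c6, c7, p, q, d, e]"
  defines "out \<equiv> exec a b ([X, Y, Z, f] @ pre) addition_prog"
  defines "u \<equiv> X * c1 - Z" and "v \<equiv> Y * c2 - Z"
  defines "G \<equiv> c3 * u + c4 * v"
  defines "J \<equiv> (c5 * v + c6 * u) * v + c7 * u * u + G * Z"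
  shows "out ! 33 = (G * u - J) * p" "out ! 36 = (G * v - J) * q" "out ! 30 = J"
    "out ! 42 = f * (d * u + v + e * (u - v))"
  by (simp_all add: out_def addition_prog_def pre_def u_def v_def G_def J_def)


section \<open>The chord-and-tangent law\<close>

locale huff_curve =
  fixes a b :: "'f::field"
  assumes ab: "a * b * (a - b) \<noteq> 0" and two: "(2::'f) \<noteq> 0"
begin

abbreviation "E \<equiv> huff_points UNIV a b"

lemma a_nz: "a \<noteq> 0" and b_nz: "b \<noteq> 0" and ab_nz: "a - b \<noteq> 0" "a \<noteq> b"
  using ab by auto

lemma huff_grad_nonzero:
  assumes "(X, Y, Z) \<noteq> (0, 0, 0)" "huff_form a b (X, Y, Z) = 0"
  shows "huff_grad a b (X, Y, Z) \<noteq> (0, 0, 0)"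
proof
  assume "huff_grad a b (X, Y, Z) = (0, 0, 0)"
  then have *: "a * Y\<^sup>2 - Z\<^sup>2 - 2 * b * X * Y = 0" "2 * a * X * Y - b * X\<^sup>2 + Z\<^sup>2 = 0"
     "2 * Z * (Y - X) = 0"
    by (auto simp: huff_grad_def algebra_simps)
  show False
  proof (cases "Z = 0")
    case True
    then have "Y * (a * Y - 2 * b * X) = 0" "X * (2 * a * Y - b * X) = 0"
      using * by algebra+
    moreover have "3 * X * b = 0 \<and> 3 * Y * a = 0" if "a * Y = 2 * b * X" "2 * a * Y = b * X"
      using that by algebra
    \<comment> \<open>In characteristic 3 the gradient alone does not force \<open>X = Y = 0\<close>
      here; the equation of the curve does.\<close>
    moreover have "X * Y * (a * Y - b * X) = 0"
      using assms(2) True unfolding huff_form_def prod.case by algebra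
    moreover have "(2::'f) \<noteq> 1"
      by (metis add_cancel_right_right one_add_one zero_neq_one)
    ultimately show False
      using assms(1) True a_nz b_nz two by auto
  next
    case False
    then have "Y = X"
      using * two by auto
    moreover have "X * X * X * (a - b) = 0"
      using assms(2) unfolding huff_form_def prod.case \<open>Y = X\<close> by algebra
    ultimately have "X = 0" "Y = 0"
      using ab_nz by auto
    then show False
      using * False by auto
  qed
qed

text \<open>For \<open>A = B\<close> the multiplicity at \<open>A\<close> is at least 2, so the
  linear coefficient along the line vanishes. It is the gradient at \<open>A\<close> applied to a
  second point of the line.\<close>

lemma line_through_of_line_divisor:
  assumes "line_divisor a b l {#A, B, C#}" "l \<noteq> (0, 0, 0)" "A \<in> E" "B \<in> E"
  shows "line_through a b A B l"
proof (cases "A = B")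
  case False
  with assms show ?thesis
    by (auto simp: line_through_def line_divisor_def)
next
  case True
  obtain X Y Z where A: "A = proj (X, Y, Z)" "(X, Y, Z) \<noteq> (0, 0, 0)" "huff_form a b (X, Y, Z) = 0"
    using assms(3) by (rule huff_pointsE)
  obtain V where V: "V \<noteq> (0, 0, 0)" "lin l V = 0" "proj (X, Y, Z) \<noteq> proj V"
    using line_second_point[OF assms(2)] by metis
  obtain X' Y' Z' where V': "V = (X', Y', Z')"
    by (metis prod_cases3)
  have lA: "lin l (X, Y, Z) = 0"
    using assms(1) by (auto simp: line_divisor_def A on_line_proj)
  have "order 0 (huff_along a b (X, Y, Z) V) = count {#A, B, C#} A" "huff_along a b (X, Y, Z) V \<noteq> 0"
    using assms(1) A V lA unfolding line_divisor_def by blast+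
  then have "order 0 (huff_along a b (X, Y, Z) V) \<ge> 2" "huff_along a b (X, Y, Z) V \<noteq> 0"
    using True by auto
  then have "[:- 0, 1:] ^ 2 dvd huff_along a b (X, Y, Z) V"
    by (simp add: order_divides del: minus_zero)
  then have "coeff (huff_along a b (X, Y, Z) V) 1 = 0"
    by (auto simp: power2_eq_square elim!: dvdE)
  moreover have "huff_along a b (X, Y, Z) V = huff_form [:a:] [:b:] 
      (smult X [:1, 0:] + smult X' [:0, 1:], smult Y [:1, 0:] + smult Y' [:0, 1:], smult Z [:1, 0:] + smult Z' [:0, 1:])"
    by (simp add: huff_along_def V')
  ultimately have "lin (huff_grad a b (X, Y, Z)) V = 0"
    unfolding huff_form_combination by (simp add: V' power2_eq_square power3_eq_cube)
  \<comment> \<open>Euler's relation: the tangent passes through \<open>A\<close>.\<close>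
  moreover have "lin (huff_grad a b (X, Y, Z)) (X, Y, Z) = 3 * huff_form a b (X, Y, Z)"
    by (simp add: huff_grad_def lin_def huff_form_def) algebra
  ultimately have "proj l = proj (huff_grad a b (X, Y, Z))"
    using line_unique[OF assms(2) huff_grad_nonzero[OF A(2,3)] A(2) V(1) V(3) lA V(2)] A(3) by simp
  with assms(2) show ?thesis
    by (simp add: True[symmetric] A(1) line_through_tangent mem_proj_iff)
qed

lemma line_through_unique:
  assumes "line_through a b A B l" "line_through a b A B l'" "A \<in> E" "B \<in> E"
  shows "proj l = proj l'"
proof -
  obtain X Y Z X' Y' Z' where *: "A = proj (X, Y, Z)" "(X, Y, Z) \<noteq> (0, 0, 0)"
     "B = proj (X', Y', Z')" "(X', Y', Z') \<noteq> (0, 0, 0)"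
    using assms(3,4) by (metis huff_pointsE)
  have nz: "l \<noteq> (0, 0, 0)" "l' \<noteq> (0, 0, 0)"
    using assms by (auto simp: line_through_def)
  show ?thesis
  proof (cases "A = B")
    case True
    then show ?thesis
      using assms(1,2) nz by (simp add: *(1) line_through_tangent mem_proj_iff flip: True)
  next
    case False
    then have "on_line l A" "on_line l B" "on_line l' A" "on_line l' B"
      using assms by (auto simp: line_through_def)
    then show ?thesis
      using line_unique[OF nz *(2,4)] False by (simp add: * on_line_proj)
  qed
qed

text \<open>With the intersection multiset, tangents and inflection points need no separate
  treatment and the symmetry is immediate.\<close>

definition coll :: "'f point \<Rightarrow> 'f point \<Rightarrow> 'f point \<Rightarrow> bool" where
  "coll A B C \<longleftrightarrow> A \<in> E \<and> B \<in> E \<and> C \<in> E \<and> (\<exists>l. l \<noteq> (0, 0, 0) \<and> line_divisor a b l {#A, B, C#})"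

lemma coll_swap: "coll A B C \<Longrightarrow> coll B A C" "coll A B C \<Longrightarrow> coll A C B"
  by (auto simp: coll_def add_mset_commute)

text \<open>The line through \<open>A\<close> and \<open>B\<close> is unique and so is its divisor;
  cancelling \<open>A\<close> and \<open>B\<close> leaves the third point.\<close>

lemma third_point_eq:
  assumes "coll A B C"
  shows "third_point a b A B = C"
proof -
  obtain l where l: "A \<in> E" "B \<in> E" "C \<in> E" "l \<noteq> (0, 0, 0)" "line_divisor a b l {#A, B, C#}"
    using assms by (auto simp: coll_def)
  have *: "line_through a b A B l"
    using l by (intro line_through_of_line_divisor)
  show ?thesis
    unfolding third_point_def
  proof (rule the_equality)
    show "C \<in> E \<and> (\<exists>l. line_through a b A B l \<and> line_divisor a b l {#A, B, C#})"
      using l(3,5) * by (intro conjI exI[of _ l])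
  next
    fix S
    assume "S \<in> E \<and> (\<exists>l. line_through a b A B l \<and> line_divisor a b l {#A, B, S#})"
    then obtain l' where l': "S \<in> E" "line_through a b A B l'" "line_divisor a b l' {#A, B, S#}"
      by auto
    have "{#A, B, S#} = {#A, B, C#}"
      using line_divisor_unique[OF l(5) l'(3) line_through_unique[OF * l'(2) l(1,2)] l(4)] l l'(1) by auto
    then show "S = C"
      by simp
  qed
qed

section \<open>Weierstrass coordinates and collinear points\<close>

text \<open>
  In the linear coordinates \<open>(T : Z : W) = (X : Z : X - Y)\<close> the curve is the Weierstrass cubic
  \<open>Z\<^sup>2 W = T (T - W) ((a - b) T - a W)\<close> with \<open>O\<close> at infinity.
\<close>

definition pt :: "'f \<Rightarrow> 'f \<Rightarrow> 'f point" where
  "pt t z = proj (t, t - 1, z)"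

definition affine :: "'f \<Rightarrow> 'f \<Rightarrow> bool" where
  "affine t z \<longleftrightarrow> z\<^sup>2 = t * (t - 1) * ((a - b) * t - a)"

lemma affine_minus [simp]: "affine t (- z) \<longleftrightarrow> affine t z"
  by (simp add: affine_def)

lemma huff_pointsI: "V \<noteq> (0, 0, 0) \<Longrightarrow> huff_form a b V = 0 \<Longrightarrow> proj V \<in> E"
  unfolding huff_points_def by fastforce

lemma collI:
  "A \<in> E \<Longrightarrow> B \<in> E \<Longrightarrow> C \<in> E \<Longrightarrow> l \<noteq> (0, 0, 0) \<Longrightarrow> line_divisor a b l {#A, B, C#} \<Longrightarrow> coll A B C"
  unfolding coll_def by blast

lemma pt_in_E:
  assumes "affine t z"
  shows "pt t z \<in> E"
proof -
  have "huff_form a b (t, t - 1, z) = 0"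
    using assms unfolding huff_form_def affine_def prod.case by algebra
  then show ?thesis
    unfolding pt_def by (auto intro: huff_pointsI)
qed

lemma huff_O_in_E: "huff_O \<in> E"
proof -
  have "huff_form a b (0, 0, 1) = 0"
    by (simp add: huff_form_def)
  then show ?thesis
    unfolding huff_O_def by (auto intro: huff_pointsI)
qed

text \<open>For \<open>X = Y\<close> the equation becomes \<open>(a - b) X ^ 3 = 0\<close>, which
  leaves only \<open>huff_O\<close>; otherwise one divides by \<open>X - Y\<close>.\<close>

lemma E_cases:
  assumes "A \<in> E"
  obtains (O) "A = huff_O" | (affine) t z where "A = pt t z" "affine t z"
proof -
  obtain X Y Z where A: "A = proj (X, Y, Z)" "(X, Y, Z) \<noteq> (0, 0, 0)" "huff_form a b (X, Y, Z) = 0"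
    using assms by (rule huff_pointsE)
  show thesis
  proof (cases "X = Y")
    case True
    then have "(a - b) * X ^ 3 = 0"
      using A(3) by (simp add: huff_form_def algebra_simps power2_eq_square power3_eq_cube)
    then have "X = 0" "Y = 0"
      using True ab_nz by auto
    then have "A = huff_O"
      using A proj_scale[of Z 0 0 1] by (simp add: huff_O_def)
    then show thesis
      by (rule O)
  next
    case False
    define W where "W = X - Y"
    have W: "W \<noteq> 0"
      using False by (simp add: W_def)
    have "A = pt (X / W) (Z / W)"
      using proj_scale[OF W, of "X / W" "X / W - 1" "Z / W"] W
      by (simp add: A pt_def right_diff_distrib) (simp add: W_def)
    moreover have "Z\<^sup>2 * W = X * (X - W) * ((a - b) * X - a * W)"
      using A(3) unfolding huff_form_def prod.case W_def by algebra
    then have "affine (X / W) (Z / W)"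
      using W by (simp add: affine_def field_simps power2_eq_square)
    ultimately show thesis
      by (rule affine)
  qed
qed

lemma coll_vertical:
  assumes "affine t z"
  shows "coll huff_O (pt t z) (pt t (- z))"
proof -
  \<comment> \<open>At \<open>s (0, 0, 1) + w (t, t - 1, 0)\<close> the form is
    \<open>w (z w - s) (z w + s)\<close>.\<close>
  have "line_divisor a b (1 - t, t, 0) {#proj (1 * 0 - 0 * t, 1 * 0 - 0 * (t - 1), 1 * 1 - 0 * 0),
     proj (z * 0 - (- 1) * t, z * 0 - (- 1) * (t - 1), z * 1 - (- 1) * 0),
     proj (z * 0 - 1 * t, z * 0 - 1 * (t - 1), z * 1 - 1 * 0)#}"
    using assms
    by (intro line_divisor_of_factors)
      (auto simp: proj_eq_iff lin_def huff_form_def huff_grad_def affine_def power2_eq_square algebra_simps)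
  moreover have "proj (- t, 1 - t, z) = pt t (- z)"
    using proj_scale[of "- 1" t "t - 1" "- z"] by (simp add: pt_def)
  ultimately have "line_divisor a b (1 - t, t, 0) {#huff_O, pt t z, pt t (- z)#}"
    by (simp add: pt_def huff_O_def)
  then show ?thesis
    by (rule collI[rotated 4]) (use assms in \<open>auto simp: pt_in_E huff_O_in_E\<close>)
qed

lemma coll_O: "coll huff_O huff_O huff_O"
proof -
  \<comment> \<open>At \<open>s (0, 0, 1) + w (1, 1, 0)\<close> the form is
    \<open>(a - b) w ^ 3\<close>, so \<open>huff_O\<close> is an inflection point.\<close>
  have "line_divisor a b (1, - 1, 0) {#proj ((a - b) * 0 - 0 * 1, (a - b) * 0 - 0 * 1, (a - b) * 1 - 0 * 0),
     proj (1 * 0 - 0 * 1, 1 * 0 - 0 * 1, 1 * 1 - 0 * 0),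
     proj (1 * 0 - 0 * 1, 1 * 0 - 0 * 1, 1 * 1 - 0 * 0)#}"
    using ab_nz
    by (intro line_divisor_of_factors)
      (auto simp: proj_eq_iff lin_def huff_form_def huff_grad_def)
  moreover have "proj (0, 0, a - b) = huff_O"
    using proj_scale[of "a - b" 0 0 1] ab_nz by (simp add: huff_O_def)
  ultimately have "line_divisor a b (1, - 1, 0) {#huff_O, huff_O, huff_O#}"
    by (simp add: huff_O_def)
  then show ?thesis
    by (rule collI[rotated 4]) (auto simp: huff_O_in_E)
qed

text \<open>
  Comparison of coefficients in
  \<open>t (t - 1) ((a - b) t - a) - (s t + d)\<^sup>2 = (a - b) (t - t\<^sub>1) (t - t\<^sub>2) (t - t\<^sub>3)\<close>.
\<close>

definition vieta :: "'f \<Rightarrow> 'f \<Rightarrow> 'f \<Rightarrow> 'f \<Rightarrow> 'f \<Rightarrow> bool" where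
  "vieta s d t1 t2 t3 \<longleftrightarrow>
     (a - b) * (t1 + t2 + t3) = s\<^sup>2 + (2 * a - b) \<and>
     (a - b) * (t1 * t2 + t1 * t3 + t2 * t3) = a - 2 * s * d \<and>
     (a - b) * t1 * t2 * t3 = d\<^sup>2"

lemma vieta_swap: "vieta s d t1 t2 t3 \<Longrightarrow> vieta s d t2 t1 t3" "vieta s d t1 t2 t3 \<Longrightarrow> vieta s d t3 t2 t1"
  by (simp_all add: vieta_def algebra_simps)

lemma vieta_affine:
  assumes "vieta s d t1 t2 t3"
  shows "affine t1 (s * t1 + d)"
  using assms unfolding vieta_def affine_def by algebra

text \<open>The points \<open>(1, 1, s)\<close> and \<open>(0, - 1, d)\<close> span the line
  \<open>Z = s X + d W\<close>; on it the form is the homogenized cubic that \<open>vieta\<close>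
  splits.\<close>

lemma coll_of_vieta:
  assumes "vieta s d t1 t2 t3"
  shows "coll (pt t1 (s * t1 + d)) (pt t2 (s * t2 + d)) (pt t3 (s * t3 + d))"
proof -
  let ?c = "a - b"
  let ?S = "\<lambda>m n. proj (n * 1 - m * 0, n * 1 - m * (- 1), n * s - m * d)"
  have S: "?S m (- (m * t)) = pt t (s * t + d)" if "m \<noteq> 0" for m t
  proof -
    have "- (m * t) * s - m * d = - m * (s * t + d)" "- (m * t) * 1 - m * 0 = - m * t"
      "- (m * t) * 1 - m * (- 1) = - m * (t - 1)"
      by (simp_all add: algebra_simps)
    then show ?thesis
      using that by (simp only: pt_def proj_scale neg_equal_0_iff_equal not_False_eq_True)
  qed
  have *: "?c * (t1 + t2 + t3) = s\<^sup>2 + (2 * a - b)" "?c * (t1 * t2 + t1 * t3 + t2 * t3) = a - 2 * s * d"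
    "?c * t1 * t2 * t3 = d\<^sup>2"
    using assms by (auto simp: vieta_def)
  have "line_divisor a b (s + d, - d, - 1) {#?S ?c (- (?c * t1)), ?S 1 (- (1 * t2)), ?S 1 (- (1 * t3))#}"
  proof (rule line_divisor_of_factors)
    show "huff_form a b (1, 1, s) = ?c * 1 * 1"
      by (simp add: huff_form_def)
    show "lin (huff_grad a b (1, 1, s)) (0, - 1, d) =
      ?c * 1 * - (1 * t3) + ?c * - (1 * t2) * 1 + - (?c * t1) * 1 * 1"
      using *(1) by (simp add: lin_def huff_grad_def) algebra
    show "lin (huff_grad a b (0, - 1, d)) (1, 1, s) =
      ?c * - (1 * t2) * - (1 * t3) + - (?c * t1) * 1 * - (1 * t3) + - (?c * t1) * - (1 * t2) * 1"
      using *(2) by (simp add: lin_def huff_grad_def) algebra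
    show "huff_form a b (0, - 1, d) = - (?c * t1) * - (1 * t2) * - (1 * t3)"
      using *(3) by (simp add: huff_form_def)
  qed (use ab_nz in \<open>auto simp: lin_def proj_eq_iff\<close>)
  then have "line_divisor a b (s + d, - d, - 1)
      {#pt t1 (s * t1 + d), pt t2 (s * t2 + d), pt t3 (s * t3 + d)#}"
    using ab_nz by (simp only: S one_neq_zero not_False_eq_True)
  moreover have "affine t1 (s * t1 + d)" "affine t2 (s * t2 + d)" "affine t3 (s * t3 + d)"
    using assms vieta_affine vieta_swap by blast+
  ultimately show ?thesis
    by (intro collI) (auto simp: pt_in_E)
qed

text \<open>The slope is that of the chord or, by implicit differentiation, of the tangent; opposite
  points are excluded because their line is vertical. The sum of the roots then defines
  \<open>t3\<close>.\<close>

lemma vieta_exists: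
  assumes 1: "affine t1 z1" and 2: "affine t2 z2" and ne: "t1 \<noteq> t2 \<or> z1 \<noteq> - z2"
  obtains s d t3 where "vieta s d t1 t2 t3" "z1 = s * t1 + d" "z2 = s * t2 + d"
proof -
  let ?c = "a - b"
  define s where slope_def: "s = (if t1 = t2 then (3 * ?c * t1\<^sup>2 - 2 * (2 * a - b) * t1 + a) / (2 * z1) else (z1 - z2) / (t1 - t2))"
  define d where icept_def: "d = z1 - s * t1"
  define t3 where "t3 = (s\<^sup>2 + (2 * a - b)) / ?c - t1 - t2"
  have s: "?c * (t1 + t2 + t3) = s\<^sup>2 + (2 * a - b)"
    using ab_nz by (simp add: t3_def)
  \<comment> \<open>Defects of the two remaining Vieta conditions. A common point of line and curve
    over \<open>t\<close> gives \<open>u * t = v\<close>; two abscissas, or one and the tangent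
    slope, force both to vanish.\<close>
  define u where "u = ?c * (t1 * t2 + t1 * t3 + t2 * t3) - (a - 2 * s * d)"
  define v where "v = ?c * t1 * t2 * t3 - d\<^sup>2"
  have z1: "z1 = s * t1 + d"
    by (simp add: icept_def)
  have uv1: "u * t1 = v"
    using 1 s unfolding affine_def u_def v_def z1 by algebra
  have "z2 = s * t2 + d \<and> u = 0"
  proof (cases "t1 = t2")
    case True
    have "(z1 - z2) * (z1 + z2) = 0"
      using 1 2 unfolding affine_def True by algebra
    then have z: "z2 = z1"
      using ne True by (auto simp: add_eq_0_iff)
    then have "z1 \<noteq> 0"
      using ne True by auto
    then have "2 * z1 * s = 3 * ?c * t1\<^sup>2 - 2 * (2 * a - b) * t1 + a"
      using two True by (simp add: slope_def)
    then have "u = 0"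
      using s unfolding u_def icept_def True by algebra
    then show ?thesis
      using True z z1 by simp
  next
    case False
    then have l: "s * (t1 - t2) = z1 - z2"
      by (simp add: slope_def)
    then have z2: "z2 = s * t2 + d"
      by (simp add: icept_def algebra_simps)
    have "u * t2 = v"
      using 2 s unfolding affine_def u_def v_def z2 by algebra
    then have "u * (t1 - t2) = 0"
      using uv1 by (simp add: right_diff_distrib)
    then show ?thesis
      using False z2 by simp
  qed
  then show thesis
    using that[of s d t3] s z1 uv1 by (simp add: vieta_def u_def v_def)
qed

section \<open>Negation and addition\<close>

definition neg :: "'f point \<Rightarrow> 'f point" where
  "neg A = third_point a b huff_O A"

lemma neg_O [simp]: "neg huff_O = huff_O"
  by (simp add: neg_def third_point_eq[OF coll_O])

lemma neg_pt [simp]: "affine t z \<Longrightarrow> neg (pt t z) = pt t (- z)"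
  by (simp add: neg_def third_point_eq[OF coll_vertical])

lemma neg_closed [simp]: "A \<in> E \<Longrightarrow> neg A \<in> E"
  by (auto elim!: E_cases simp: pt_in_E huff_O_in_E)

lemma neg_neg [simp]: "A \<in> E \<Longrightarrow> neg (neg A) = A"
  by (auto elim!: E_cases)

lemma huff_add_eq: "huff_add a b A B = neg (third_point a b A B)"
  by (simp add: huff_add_def neg_def)

lemma coll_O_neg: "A \<in> E \<Longrightarrow> coll huff_O A (neg A)"
  by (auto elim!: E_cases simp: coll_O coll_vertical)

text \<open>Changing the sign of \<open>z\<close> preserves the curve and maps lines to lines. Both
  collinearities are stated for the same \<open>C\<close> so that negation commutes with taking the
  third point.\<close>

lemma coll_exists:
  assumes "A \<in> E" "B \<in> E"
  shows "\<exists>C. coll A B C \<and> coll (neg A) (neg B) (neg C)"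
  using assms(1)
proof (cases rule: E_cases)
  case O
  then show ?thesis
    using coll_O_neg[of B] coll_O_neg[of "neg B"] assms by (intro exI[of _ "neg B"]) simp
next
  case 1: (affine t1 z1)
  show ?thesis
    using assms(2)
  proof (cases rule: E_cases)
    case O
    then show ?thesis
      using coll_swap(1)[OF coll_O_neg, of A] coll_swap(1)[OF coll_O_neg, of "neg A"] assms
      by (intro exI[of _ "neg A"]) simp
  next
    case 2: (affine t2 z2)
    show ?thesis
    proof (cases "t1 = t2 \<and> z1 = - z2")
      case True
      then have B: "B = neg A"
        using 1 2 by auto
      have "coll S (neg S) huff_O" if "S \<in> E" for S
        using that by (intro coll_swap(2)[OF coll_swap(1)[OF coll_O_neg]])
      from this[OF assms(1)] this[OF assms(2)] show ?thesis
        using assms(1) by (intro exI[of _ huff_O]) (simp add: B)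
    next
      case False
      then obtain s d t3 where v: "vieta s d t1 t2 t3" "z1 = s * t1 + d" "z2 = s * t2 + d"
        using vieta_exists 1 2 by metis
      then have "vieta (- s) (- d) t1 t2 t3"
        by (simp add: vieta_def)
      then have "coll (pt t1 (- z1)) (pt t2 (- z2)) (pt t3 (- (s * t3 + d)))"
        using coll_of_vieta[of "- s" "- d" t1 t2 t3] v by simp
      moreover have "affine t3 (s * t3 + d)"
        using v(1) vieta_affine vieta_swap by blast
      ultimately show ?thesis
        using coll_of_vieta[OF v(1)] 1 2 v(2,3) by (intro exI[of _ "pt t3 (s * t3 + d)"]) simp
    qed
  qed
qed

lemma coll_third_point: "A \<in> E \<Longrightarrow> B \<in> E \<Longrightarrow> coll A B (third_point a b A B)"
  using coll_exists third_point_eq by metis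

lemma third_point_closed [simp]: "A \<in> E \<Longrightarrow> B \<in> E \<Longrightarrow> third_point a b A B \<in> E"
  using coll_third_point by (auto simp: coll_def)

lemma huff_add_closed [simp]: "A \<in> E \<Longrightarrow> B \<in> E \<Longrightarrow> huff_add a b A B \<in> E"
  by (simp add: huff_add_eq)

lemma third_point_comm: "A \<in> E \<Longrightarrow> B \<in> E \<Longrightarrow> third_point a b A B = third_point a b B A"
  using coll_third_point coll_swap third_point_eq by metis

lemma third_point_cancel: "A \<in> E \<Longrightarrow> B \<in> E \<Longrightarrow> third_point a b A (third_point a b A B) = B"
  using coll_third_point coll_swap third_point_eq by metis

lemma neg_third_point: "A \<in> E \<Longrightarrow> B \<in> E \<Longrightarrow> neg (third_point a b A B) = third_point a b (neg A) (neg B)"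
  using coll_exists third_point_eq by metis

lemma huff_add_comm: "A \<in> E \<Longrightarrow> B \<in> E \<Longrightarrow> huff_add a b A B = huff_add a b B A"
  by (simp add: huff_add_eq third_point_comm)

lemma huff_add_O [simp]: "A \<in> E \<Longrightarrow> huff_add a b A huff_O = A"
  using third_point_cancel[of huff_O A] third_point_comm[of huff_O A] huff_O_in_E
  by (simp add: huff_add_eq neg_def)

lemma huff_add_neg_self: "A \<in> E \<Longrightarrow> huff_add a b A (neg A) = huff_O"
  using third_point_eq[OF coll_swap(1)[OF coll_swap(2)[OF coll_swap(1)[OF coll_O_neg]]], of A]
    third_point_comm[of A "neg A"]
  by (simp add: huff_add_eq)

lemma neg_huff_add: "A \<in> E \<Longrightarrow> B \<in> E \<Longrightarrow> neg (huff_add a b A B) = huff_add a b (neg A) (neg B)"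
  by (simp add: huff_add_eq neg_third_point)

text \<open>No associativity is involved: reflecting the line through \<open>A\<close>,
  \<open>B\<close> and \<open>- (A + B)\<close> shows that \<open>A + B\<close>, \<open>- A\<close>
  and \<open>- B\<close> are collinear.\<close>

lemma huff_add_cancel: "A \<in> E \<Longrightarrow> B \<in> E \<Longrightarrow> huff_add a b (huff_add a b A B) (neg A) = B"
  by (simp add: huff_add_eq neg_third_point third_point_comm third_point_cancel)

section \<open>An instance of associativity\<close>

text \<open>
  The slope \<open>s + s' - s0\<close> of the third line becomes visible after moving the point over \<open>t1\<close> to
  \<open>t = 0\<close> and solving the conditions on the first three lines for \<open>t3, t4, t0\<close>.
\<close>

lemma vieta_identity:
  assumes v: "vieta s d t1 t2 t3" "vieta s' d' t1 t2 t4" "vieta s0 d0 t1 t1 t0"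
    and z: "s * t1 + d = z1" "s * t2 + d = z2" "s' * t1 + d' = z1" "s' * t2 + d' = - z2" "s0 * t1 + d0 = z1"
    and ne: "t1 \<noteq> t2"
  obtains n e where "vieta n e t0 t4 t3" "n * t0 + e = - (s0 * t0 + d0)" "n * t4 + e = s' * t4 + d'"
    "n * t3 + e = s * t3 + d"
proof -
  \<comment> \<open>For a line of slope \<open>s\<close> through the point over \<open>t1\<close>,
    \<open>c\<close> times the sum of the other two shifted roots is
    \<open>s ^ 2 - f\<close>.\<close>
  define c f where "c = a - b" "f = 3 * (a - b) * t1 - (2 * a - b)"
  define x2 x3 x4 x0 where "x2 = t2 - t1" "x3 = t3 - t1" "x4 = t4 - t1" "x0 = t0 - t1"
  have c: "c \<noteq> 0" and x2: "x2 \<noteq> 0"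
    using ab_nz ne by (auto simp: c_f_def x2_x3_x4_x0_def)
  have S: "c * (x2 + x3) = s\<^sup>2 - f" and X0: "c * x0 = s0\<^sup>2 - f"
    using v unfolding vieta_def c_f_def x2_x3_x4_x0_def by algebra+
  have P: "c * x2 * x3 = 2 * z1 * (s0 - s)" "c * x2 * x4 = 2 * z1 * (s0 - s')"
    and tangent: "3 * c * t1\<^sup>2 - 2 * (2 * a - b) * t1 + a = 2 * s0 * z1"
  proof -
    \<comment> \<open>Both sides are the derivative at \<open>t1\<close> of the cubic minus the
      squared line.\<close>
    have *: "(a - b) * (u - t1) * (w - t1) = 3 * (a - b) * t1\<^sup>2 - 2 * (2 * a - b) * t1 + a - 2 * g * (g * t1 + h)"
      if "vieta g h t1 u w" for g h u w
      using that unfolding vieta_def by algebra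
    show t: "3 * c * t1\<^sup>2 - 2 * (2 * a - b) * t1 + a = 2 * s0 * z1"
      using *[OF v(3)] by (simp add: z c_f_def)
    show "c * x2 * x3 = 2 * z1 * (s0 - s)" "c * x2 * x4 = 2 * z1 * (s0 - s')"
      using *[OF v(1)] *[OF v(2)] t by (simp_all add: z c_f_def x2_x3_x4_x0_def right_diff_distrib)
  qed
  have "s * x2 = z2 - z1"
    unfolding z(2)[symmetric] z(1)[symmetric] x2_x3_x4_x0_def by (simp add: algebra_simps)
  moreover have "s' * x2 = - z2 - z1"
    unfolding z(4)[symmetric] z(3)[symmetric] x2_x3_x4_x0_def by (simp add: algebra_simps)
  \<comment> \<open>Adding the slopes of the chords to \<open>(t2, z2)\<close> and
    \<open>(t2, - z2)\<close> eliminates \<open>z2\<close>.\<close>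
  ultimately have z1: "2 * z1 = - (s + s') * x2"
    by algebra
  have "x2 * (c * x3) = x2 * (- (s + s') * (s0 - s))" "x2 * (c * x4) = x2 * (- (s + s') * (s0 - s'))"
    using P unfolding z1 by (simp_all only: ac_simps)
  then have X3: "c * x3 = - (s + s') * (s0 - s)" and X4: "c * x4 = - (s + s') * (s0 - s')"
    using x2 by simp_all
  have X2: "c * x2 = (s + s') * (s0 - s) + s\<^sup>2 - f"
    using S X3 by (simp add: distrib_left algebra_simps)
  have Z: "2 * (c * z1) = - (s + s') * ((s + s') * (s0 - s) + s\<^sup>2 - f)"
    using z1 X2 by algebra
  \<comment> \<open>Slope \<open>n\<close> of the fourth line and its value \<open>h\<close> at
    \<open>t1\<close>, chosen so that the line passes through the third point of the first
    chord.\<close>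
  define n where "n = s + s' - s0"
  define h where "h = z1 + (s0 - s') * x3"
  define e where "e = h - n * t1"
  have H: "2 * (c * h) = 2 * (c * z1) + 2 * (s0 - s') * (c * x3)"
    by (simp add: h_def algebra_simps)
  have cancel: "x = y" if "c * x = c * y" for x y
    using c that by simp
  have W1: "c * (x0 + x4 + x3) = n\<^sup>2 - f"
    unfolding distrib_left X0 X3 X4 n_def by algebra
  have W2: "c * (x0 * x4 + x0 * x3 + x4 * x3) = 2 * s0 * z1 - 2 * n * h"
  proof (rule cancel)
    have "c * (c * (x0 * x4 + x0 * x3 + x4 * x3)) = (c * x0) * (c * x4) + (c * x0) * (c * x3) + (c * x4) * (c * x3)"
      by algebra
    also have "\<dots> = s0 * (2 * (c * z1)) - n * (2 * (c * h))"
      unfolding H Z X0 X3 X4 n_def by algebra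
    finally show "c * (c * (x0 * x4 + x0 * x3 + x4 * x3)) = c * (2 * s0 * z1 - 2 * n * h)"
      by algebra
  qed
  have W3: "c * x0 * x4 * x3 = h\<^sup>2 - z1\<^sup>2"
  proof (rule cancel, rule cancel)
    have "c * (c * (c * x0 * x4 * x3)) = (c * x0) * (c * x4) * (c * x3)"
      by algebra
    also have "\<dots> = (s0 - s') * (c * x3) * (2 * (c * z1) + (s0 - s') * (c * x3))"
      unfolding Z X0 X3 X4 by algebra
    also have "\<dots> = c * (c * (h\<^sup>2 - z1\<^sup>2))"
      unfolding h_def by algebra
    finally show "c * (c * (c * x0 * x4 * x3)) = c * (c * (h\<^sup>2 - z1\<^sup>2))" .
  qed
  \<comment> \<open>By the symmetry between \<open>s\<close> and \<open>s'\<close> the same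
    \<open>h\<close> fits the point over \<open>t4\<close>.\<close>
  have h4: "h = z1 + (s0 - s) * x4"
  proof -
    have "(s0 - s') * x3 = (s0 - s) * x4"
      by (rule cancel) (use X3 X4 in algebra)
    then show ?thesis
      by (simp add: h_def)
  qed
  \<comment> \<open>The line also contains the reflection of the third point of the tangent.\<close>
  have h0: "(n + s0) * x0 + z1 + h = 0"
  proof -
    have "c * (2 * ((n + s0) * x0 + z1 + h)) = 2 * (n + s0) * (c * x0) + 2 * (c * z1) + 2 * (c * h)"
      by algebra
    also have "\<dots> = 0"
      unfolding H Z X0 X3 n_def by algebra
    finally show ?thesis
      using c two by (simp only: mult_eq_0_iff) simp
  qed
  show thesis
  proof
    have "z1\<^sup>2 = t1 * (t1 - 1) * ((a - b) * t1 - a)"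
      using vieta_affine[OF v(3)] unfolding z affine_def .
    then have z1_sq: "z1\<^sup>2 = c * t1 ^ 3 - (2 * a - b) * t1\<^sup>2 + a * t1"
      unfolding c_f_def by (simp add: algebra_simps power2_eq_square power3_eq_cube)
    have "c * (t0 + t4 + t3) = c * (x0 + x4 + x3) + 3 * c * t1"
      unfolding x2_x3_x4_x0_def by algebra
    also have "\<dots> = n\<^sup>2 + (2 * a - b)"
      unfolding W1 unfolding c_f_def by algebra
    finally have V1: "c * (t0 + t4 + t3) = n\<^sup>2 + (2 * a - b)" .
    have "c * (t0 * t4 + t0 * t3 + t4 * t3) =
        c * (x0 * x4 + x0 * x3 + x4 * x3) + 2 * t1 * (c * (t0 + t4 + t3)) - 3 * c * t1\<^sup>2"
      unfolding x2_x3_x4_x0_def by algebra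
    also have "\<dots> = a - 2 * n * e"
      unfolding W2 V1 tangent[symmetric] e_def by algebra
    finally have V2: "c * (t0 * t4 + t0 * t3 + t4 * t3) = a - 2 * n * e" .
    have "c * t0 * t4 * t3 = c * x0 * x4 * x3 + t1 * (c * (t0 * t4 + t0 * t3 + t4 * t3))
        - t1\<^sup>2 * (c * (t0 + t4 + t3)) + c * t1 ^ 3"
      unfolding x2_x3_x4_x0_def by algebra
    also have "\<dots> = e\<^sup>2"
      unfolding W3 V1 V2 z1_sq e_def by algebra
    finally have "c * t0 * t4 * t3 = e\<^sup>2" .
    with V1 V2 show "vieta n e t0 t4 t3"
      by (simp add: vieta_def c_f_def)
    show "n * t3 + e = s * t3 + d"
      unfolding e_def h_def n_def z(1)[symmetric] x2_x3_x4_x0_def by (simp add: algebra_simps)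
    show "n * t4 + e = s' * t4 + d'"
      unfolding e_def h4 n_def z(3)[symmetric] x2_x3_x4_x0_def by (simp add: algebra_simps)
    show "n * t0 + e = - (s0 * t0 + d0)"
      using h0 unfolding e_def z(5)[symmetric] x2_x3_x4_x0_def by algebra
  qed
qed

text \<open>
  This instance of associativity involves only two points, and it suffices for
  \<open>n A + n A = (2 n) A\<close>: take \<open>A, B\<close> to be consecutive multiples of a point, in both orders.
\<close>

lemma huff_add_identity:
  assumes "A \<in> E" "B \<in> E"
  shows "huff_add a b (huff_add a b A A) (huff_add a b B (neg A)) = huff_add a b A B"
  using assms(1)
proof (cases rule: E_cases)
  case O
  then show ?thesis
    using assms huff_add_comm[OF huff_O_in_E, of B] by (simp add: huff_O_in_E)
next
  case A: (affine t1 z1)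
  show ?thesis
    using assms(2)
  proof (cases rule: E_cases)
    case O
    then show ?thesis
      using assms huff_add_cancel[of A A] huff_add_comm[OF huff_O_in_E, of "neg A"] by simp
  next
    case B: (affine t2 z2)
    \<comment> \<open>The chords need \<open>t1 \<noteq> t2\<close> and the tangent at
      \<open>A\<close> needs \<open>z1 \<noteq> 0\<close>; the other cases are degenerate.\<close>
    consider "B = A" | "B = neg A" | "neg A = A" | "t1 \<noteq> t2" "z1 \<noteq> 0"
    proof (cases "t1 = t2")
      case True
      then have "z2\<^sup>2 = z1\<^sup>2"
        using A(2) B(2) by (simp add: affine_def)
      then have "z2 = z1 \<or> z2 = - z1"
        by (simp add: power2_eq_iff)
      then show thesis
        using that(1,2) A B True by (metis neg_pt)
    next
      case False
      then show thesis
        using that A by (cases "z1 = 0") auto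
    qed
    then show ?thesis
    proof cases
      case 1
      then show ?thesis
        using assms by (simp add: huff_add_neg_self)
    next
      case 2
      then show ?thesis
        using assms huff_add_neg_self[of "huff_add a b A A"] by (simp add: huff_add_neg_self neg_huff_add)
    next
      case 3
      then have AA: "huff_add a b A A = huff_O"
        using huff_add_neg_self[OF assms(1)] by (simp only:)
      have "huff_add a b huff_O (huff_add a b A B) = huff_add a b A B"
        using assms huff_add_comm[OF huff_O_in_E, of "huff_add a b A B"] by simp
      then show ?thesis
        by (simp only: 3 AA huff_add_comm[OF assms(2,1)])
    next
      case 4
      have "z1 \<noteq> - z1"
      proof
        assume "z1 = - z1"
        then have "2 * z1 = 0"
          by (metis add.right_inverse mult_2)
        with 4 two show False
          by simp
      qed
      obtain s0 d0 t0 where v0: "vieta s0 d0 t1 t1 t0" "z1 = s0 * t1 + d0"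
        by (rule vieta_exists[OF A(2) A(2)]) (use \<open>z1 \<noteq> - z1\<close> in auto)
      obtain s d t3 where v: "vieta s d t1 t2 t3" "z1 = s * t1 + d" "z2 = s * t2 + d"
        by (rule vieta_exists[OF A(2) B(2)]) (use 4 in auto)
      obtain s' d' t4 where v': "vieta s' d' t1 t2 t4" "z1 = s' * t1 + d'" "- z2 = s' * t2 + d'"
        by (rule vieta_exists[OF A(2), of t2 "- z2"]) (use B(2) 4 in auto)
      obtain n e where w: "vieta n e t0 t4 t3" "n * t0 + e = - (s0 * t0 + d0)" "n * t4 + e = s' * t4 + d'"
        "n * t3 + e = s * t3 + d"
        by (rule vieta_identity[OF v(1) v'(1) v0(1) v(2)[symmetric] v(3)[symmetric]
            v'(2)[symmetric] v'(3)[symmetric] v0(2)[symmetric] 4(1)])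
      have aff: "affine t0 (s0 * t0 + d0)" "affine t4 (s' * t4 + d')" "affine t3 (s * t3 + d)"
        by (rule vieta_affine, rule vieta_swap(2), fact)+
      have AA: "huff_add a b A A = pt t0 (- (s0 * t0 + d0))"
        using third_point_eq[OF coll_of_vieta[OF v0(1)]] A v0 aff by (simp add: huff_add_eq)
      \<comment> \<open>Two signs cancel: \<open>B - A\<close> is itself the third point on the line
        through \<open>A\<close> and \<open>- B\<close>.\<close>
      have "third_point a b B (neg A) = neg (third_point a b A (neg B))"
        using assms by (simp add: neg_third_point third_point_comm)
      moreover have "third_point a b A (neg B) = pt t4 (s' * t4 + d')"
        using third_point_eq[OF coll_of_vieta[OF v'(1)]] A B v' by simp
      ultimately have BA: "huff_add a b B (neg A) = pt t4 (s' * t4 + d')"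
        using aff by (simp only: huff_add_eq neg_neg pt_in_E)
      have "third_point a b A B = pt t3 (s * t3 + d)"
        using third_point_eq[OF coll_of_vieta[OF v(1)]] A B v by simp
      then show ?thesis
        using third_point_eq[OF coll_of_vieta[OF w(1)]] unfolding AA BA w(2-4) unfolding huff_add_eq by simp
    qed
  qed
qed

section \<open>Multiples of a point\<close>

lemma huff_smult_0 [simp]: "huff_smult a b 0 A = huff_O"
  and huff_smult_Suc: "huff_smult a b (Suc n) A = huff_add a b A (huff_smult a b n A)"
  by (simp_all add: huff_smult_def)

lemma huff_smult_closed [simp]: "A \<in> E \<Longrightarrow> huff_smult a b n A \<in> E"
  by (induction n) (simp_all add: huff_smult_Suc huff_O_in_E)

text \<open>The consecutive multiples \<open>B\<close> and \<open>C\<close> differ by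
  \<open>A\<close>. The identity for \<open>(B, C)\<close> yields \<open>B + C\<close>, and for
  \<open>(C, B)\<close> it expresses \<open>C + C\<close> through \<open>B + C\<close>.\<close>

lemma huff_add_smult_self:
  assumes A: "A \<in> E"
  shows "huff_add a b (huff_smult a b n A) (huff_smult a b n A) = huff_smult a b (2 * n) A"
proof (induction n)
  case 0
  then show ?case
    by (simp add: huff_O_in_E)
next
  case (Suc n)
  define B C where "B = huff_smult a b n A" "C = huff_smult a b (Suc n) A"
  have in_E: "B \<in> E" "C \<in> E"
    using A by (simp_all add: B_C_def)
  have C: "C = huff_add a b B A"
    using A by (simp add: B_C_def huff_smult_Suc huff_add_comm)
  have CB: "huff_add a b C (neg B) = A"
    using A in_E by (simp add: C huff_add_cancel)
  have "huff_add a b (huff_add a b B B) A = huff_add a b B C"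
    using huff_add_identity[OF in_E] by (simp add: CB)
  then have BC: "huff_add a b B C = huff_smult a b (Suc (2 * n)) A"
    using Suc A by (simp add: B_C_def huff_smult_Suc huff_add_comm)
  have "huff_add a b B (neg C) = neg A"
    using CB in_E by (metis neg_closed neg_huff_add neg_neg huff_add_comm)
  then have "huff_add a b (huff_add a b C C) (neg A) = huff_add a b C B"
    using huff_add_identity[OF in_E(2,1)] by simp
  then have "huff_add a b (neg A) (huff_add a b C C) = huff_add a b B C"
    using in_E A by (simp add: huff_add_comm)
  then have "huff_add a b C C = huff_add a b A (huff_add a b B C)"
    using huff_add_cancel[of "neg A" "huff_add a b C C"] in_E A by (simp add: huff_add_comm)
  then show ?case
    unfolding BC by (simp add: B_C_def(2) huff_smult_Suc[of "Suc (2 * n)"])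
qed

text \<open>Cancelling \<open>A\<close> from \<open>n A = A\<close> gives
  \<open>(n - 1) A = O\<close>, against the order, since \<open>n\<close> even excludes
  \<open>n = 1\<close>. For \<open>n = 0\<close> the point itself would be \<open>O\<close>.\<close>

lemma huff_smult_neq:
  assumes "A \<in> E" "has_order a b A r" "even n" "n < r" "1 < r"
  shows "huff_smult a b n A \<noteq> A"
proof
  assume *: "huff_smult a b n A = A"
  have 1: "huff_smult a b 1 A = A"
    using assms(1) by (simp add: huff_smult_Suc)
  show False
  proof (cases n)
    case 0
    then show False
      using * 1 assms(2,5) by (auto simp: has_order_def)
  next
    case (Suc m)
    then have "huff_add a b A (huff_smult a b m A) = A"
      using * by (simp add: huff_smult_Suc)
    then have "huff_smult a b m A = huff_O"
      using assms(1) huff_add_cancel[of A "huff_smult a b m A"] huff_add_neg_self[of A] by simp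
    moreover have "0 < m" "m < r"
      using Suc assms by (auto intro: Nat.gr0I)
    ultimately show False
      using assms(2) by (auto simp: has_order_def)
  qed
qed

section \<open>Points in the Miller loop\<close>

lemma div_pow_Suc: "r div 2 ^ Suc i = r div 2 ^ i div 2" for r i :: nat
  by (simp add: div_mult2_eq mult.commute[of 2])

text \<open>The bits at positions \<open>\<ge> i\<close> form the number \<open>r div 2 ^ i\<close>;
  after a doubling bit \<open>i\<close> is still to be added.\<close>

lemma miller_points:
  assumes P: "P \<in> E"
  shows "miller_iter Fq Fh a b r P Q i R f \<Longrightarrow> R = huff_smult a b (r div 2 ^ i) P"
    and "miller_doubled Fq Fh a b r P Q i R f \<Longrightarrow> R = huff_smult a b (2 * (r div 2 ^ Suc i)) P"
proof (induction rule: miller_iter_miller_doubled.inducts)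
  case (start l)
  then have "r div 2 ^ l = 1"
    by (simp add: div_nat_eqI)
  then show ?case
    using P by (simp add: huff_smult_Suc)
next
  case (double i R f w u)
  then show ?case
    using P by (simp add: huff_add_smult_self del: power_Suc)
next
  case (add i R f w u)
  then have "r div 2 ^ i = Suc (2 * (r div 2 ^ Suc i))"
    by (simp add: bit_iff_odd div_pow_Suc del: power_Suc)
  then show ?case
    using P add by (simp add: huff_smult_Suc huff_add_comm del: power_Suc)
next
  case (skip i R f)
  then have "r div 2 ^ i = 2 * (r div 2 ^ Suc i)"
    by (simp add: bit_iff_odd div_pow_Suc del: power_Suc)
  then show ?case
    using skip by (simp del: power_Suc)
qed

text \<open>This rules out the exception of the addition formula: \<open>R\<close> is the multiple
  \<open>2 * m\<close> of \<open>P\<close>, and bit 1 gives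
  \<open>2 * m + 1 \<le> r\<close>.\<close>

lemma miller_doubled_neq:
  assumes "P \<in> E" "has_order a b P r" "1 < r" "miller_doubled Fq Fh a b r P Q i R f" "bit r i"
  shows "R \<noteq> P"
proof -
  have "Suc (2 * (r div 2 ^ Suc i)) = r div 2 ^ i"
    using assms(5) by (simp add: bit_iff_odd div_pow_Suc del: power_Suc)
  also have "\<dots> \<le> r"
    by simp
  finally show ?thesis
    using huff_smult_neq[OF assms(1,2) _ _ assms(3), of "2 * (r div 2 ^ Suc i)"] miller_points(2)[OF assms(1,4)] by simp
qed

section \<open>The addition step\<close>

lemma proj_in_E_iff: "proj V \<in> E \<longleftrightarrow> V \<noteq> (0, 0, 0) \<and> huff_form a b V = 0"
proof
  assume "proj V \<in> E"
  then obtain X Y Z where *: "proj (X, Y, Z) = proj V" "(X, Y, Z) \<noteq> (0, 0, 0)" "huff_form a b (X, Y, Z) = 0"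
    by (rule huff_pointsE) simp
  obtain X' Y' Z' where V: "V = (X', Y', Z')"
    by (metis prod_cases3)
  obtain c where c: "c \<noteq> 0" "X' = c * X" "Y' = c * Y" "Z' = c * Z"
    using *(1) unfolding V by (rule proj_eqD)
  have "huff_form a b (c * X, c * Y, c * Z) = c ^ 3 * huff_form a b (X, Y, Z)"
    unfolding huff_form_def prod.case by algebra
  then have "huff_form a b V = 0"
    using *(3) by (simp add: V c)
  moreover have "V \<noteq> (0, 0, 0)"
    using *(2) c(1) by (simp add: V c(2-4))
  ultimately show "V \<noteq> (0, 0, 0) \<and> huff_form a b V = 0"
    by simp
qed (simp add: huff_pointsI)

lemma neg_proj:
  assumes "(X, Y, Z) \<noteq> (0, 0, 0)" "huff_form a b (X, Y, Z) = 0"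
  shows "neg (proj (X, Y, Z)) = proj (X, Y, - Z)"
  using huff_pointsI[OF assms]
proof (cases rule: E_cases)
  case O
  then obtain c where "c \<noteq> 0" "0 = c * X" "0 = c * Y" "1 = c * Z"
    unfolding huff_O_def by (rule proj_eqD)
  then have "X = 0" "Y = 0"
    by auto
  then show ?thesis
    using O assms(1) proj_scale[of "- Z" 0 0 1] neg_O by (simp add: huff_O_def)
next
  case (affine t z)
  then obtain c where "c \<noteq> 0" "X = c * t" "Y = c * (t - 1)" "Z = c * z"
    unfolding pt_def by (metis proj_eqD)
  then show ?thesis
    using affine proj_scale[of c t "t - 1" "- z"] neg_pt[of t z] by (simp add: pt_def)
qed

text \<open>\<open>Z = 0\<close> would mean \<open>P = - P\<close>. With \<open>Z\<close> nonzero,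
  either of \<open>X = 0\<close> and \<open>Y = 0\<close> implies the other, hence
  \<open>P = O\<close>.\<close>

lemma order_gt_2_coordinates:
  assumes P: "P = proj (X, Y, Z)" "P \<in> E" and ord: "has_order a b P r" "2 < r"
  shows "X \<noteq> 0" "Y \<noteq> 0" "Z \<noteq> 0" "(X, Y, Z) \<noteq> (0, 0, 0)" "huff_form a b (X, Y, Z) = 0"
proof -
  show nz: "(X, Y, Z) \<noteq> (0, 0, 0)" and form: "huff_form a b (X, Y, Z) = 0"
    using P(2) unfolding P(1) proj_in_E_iff by blast+
  have nO: "huff_smult a b m P \<noteq> huff_O" if "0 < m" "m < r" for m
    using ord that by (simp add: has_order_def)
  have "huff_smult a b 1 P = P"
    using P(2) by (simp add: huff_smult_Suc)
  then have "P \<noteq> huff_O"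
    using nO[of 1] ord(2) by simp
  have "huff_smult a b 2 P = huff_add a b P P"
    using P(2) by (simp add: huff_smult_Suc numeral_2_eq_2)
  then have "huff_add a b P P \<noteq> huff_O"
    using nO[of 2] ord(2) by simp
  then have "neg P \<noteq> P"
    using huff_add_neg_self[OF P(2)] by metis
  then have "proj (X, Y, - Z) \<noteq> proj (X, Y, Z)"
    unfolding P(1) neg_proj[OF nz form] .
  then show Z: "Z \<noteq> 0"
    by auto
  have "Y = 0" if "X = 0"
    using form Z that by (simp add: huff_form_def)
  moreover have "X = 0" if "Y = 0"
    using form Z that by (simp add: huff_form_def)
  moreover have "\<not> (X = 0 \<and> Y = 0)"
    using \<open>P \<noteq> huff_O\<close> proj_scale[OF Z, of 0 0 1] unfolding P(1) huff_O_def by auto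
  ultimately show "X \<noteq> 0" "Y \<noteq> 0"
    by blast+
qed

text \<open>
  With \<open>R = Z P + (p u, q v, 0)\<close> the form restricted to the line through \<open>P\<close> and \<open>R\<close> is
  \<open>t (G \<zeta>\<^sup>2 + H \<zeta> t + K t\<^sup>2)\<close> at the point \<open>\<zeta> P + t (p u, q v, 0)\<close>, and \<open>R\<close> is its zero \<open>(\<zeta>, t) = (Z, 1)\<close>.
\<close>

lemma addition_formula:
  fixes X Y Z p q :: 'f
  defines "u \<equiv> X / p - Z" and "v \<equiv> Y / q - Z"
  defines "G \<equiv> p * (a * q\<^sup>2 + 1) * v - q * (b * p\<^sup>2 + 1) * u"
  defines "H \<equiv> p * q * (a * q * v\<^sup>2 + 2 * (a * q - b * p) * u * v - b * p * u\<^sup>2)"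
  defines "J \<equiv> H + G * Z"
  assumes pq: "p \<noteq> 0" "q \<noteq> 0" and P: "huff_form a b (p, q, 1) = 0"
    and R: "(X, Y, Z) \<noteq> (0, 0, 0)" "huff_form a b (X, Y, Z) = 0" "proj (X, Y, Z) \<noteq> proj (p, q, 1)"
  shows "huff_add a b (proj (X, Y, Z)) (proj (p, q, 1)) = proj (p * (G * u - J), q * (G * v - J), J)"
    and "line_through a b (proj (X, Y, Z)) (proj (p, q, 1)) (v, - (p / q) * u, p * (u - v))"
    and "(p * (G * u - J), q * (G * v - J), J) \<noteq> (0, 0, 0)"
    and "huff_form a b (p * (G * u - J), q * (G * v - J), J) = 0"
proof -
  let ?l = "(v, - (p / q) * u, p * (u - v))"
  have X: "X = p * u + Z * p" and Y: "Y = q * v + Z * q"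
    using pq by (simp_all add: u_def v_def field_simps)
  have uv: "(u, v) \<noteq> (0, 0)"
  proof
    assume "(u, v) = (0, 0)"
    then have "X = Z * p" "Y = Z * q" "Z \<noteq> 0"
      using R(1) X Y by auto
    then show False
      using R(3) proj_scale[of Z p q 1] by simp
  qed
  have eP: "p * (a * q\<^sup>2 - 1) = q * (b * p\<^sup>2 - 1)"
    using P by (simp add: huff_form_def)
  define K where "K = p * q * u * v * (a * q * v - b * p * u)"
  have c30: "huff_form a b (p, q, 1) = 0"
    by (fact P)
  have c21: "lin (huff_grad a b (p, q, 1)) (p * u, q * v, 0) = G"
  proof -
    have "lin (huff_grad a b (p, q, 1)) (p * u, q * v, 0) =
        G + (u + v) * (p * (a * q\<^sup>2 - 1) - q * (b * p\<^sup>2 - 1))"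
      by (simp add: G_def lin_def huff_grad_def algebra_simps power2_eq_square)
    then show ?thesis
      using eP by simp
  qed
  have c12: "lin (huff_grad a b (p * u, q * v, 0)) (p, q, 1) = H"
    by (simp add: H_def lin_def huff_grad_def algebra_simps power2_eq_square)
  have c03: "huff_form a b (p * u, q * v, 0) = K"
    by (simp add: K_def huff_form_def algebra_simps power2_eq_square)
  have combination: "huff_form a b (s * x + t * x', s * y + t * y', s * z + t * z') =
      s ^ 3 * huff_form a b (x, y, z) + s\<^sup>2 * t * lin (huff_grad a b (x, y, z)) (x', y', z') +
      s * t\<^sup>2 * lin (huff_grad a b (x', y', z')) (x, y, z) + t ^ 3 * huff_form a b (x', y', z')"
    for s t x y z x' y' z'
    unfolding huff_form_def lin_def huff_grad_def prod.case by algebra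
  have "huff_form a b (X, Y, Z) = Z\<^sup>2 * G + Z * H + K"
    using combination[of Z p 1 "p * u" q "q * v" 1 0] by (simp add: c30 c21 c12 c03 X Y add.commute)
  then have "K + (Z\<^sup>2 * G + Z * H) = 0"
    using R(2) by (simp add: add.commute)
  then have "K = - (Z\<^sup>2 * G + Z * H)"
    by (rule eq_neg_iff_add_eq_0[THEN iffD2])
  \<comment> \<open>The root \<open>(Z, 1)\<close> splits the quadratic into
    \<open>(\<zeta> - Z t) (G \<zeta> + J t)\<close>; the second factor gives the third
    point.\<close>
  then have K: "K = - (Z * J)"
    by (simp add: J_def algebra_simps power2_eq_square)
  have e: "(p, q, 1) \<noteq> (0, 0, 0)" "(p * u, q * v, 0) \<noteq> (0, 0, 0)" "proj (p, q, 1) \<noteq> proj (p * u, q * v, 0)"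
    using pq uv by (auto simp: proj_eq_iff)
  have lP: "lin l (p, q, 1) = 0" "lin l (p * u, q * v, 0) = 0"
    if "on_line l (proj (p, q, 1))" "on_line l (proj (X, Y, Z))" for l
  proof -
    have "lin l (p * u, q * v, 0) = lin l (X, Y, Z) - Z * lin l (p, q, 1)"
      unfolding X Y by (cases l) (simp add: lin_def algebra_simps)
    then show "lin l (p, q, 1) = 0" "lin l (p * u, q * v, 0) = 0"
      using that by (simp_all add: on_line_proj)
  qed
  have in_E: "proj (p, q, 1) \<in> E" "proj (X, Y, Z) \<in> E"
    using P R by (auto intro: huff_pointsI)
  \<comment> \<open>Otherwise the form would vanish on the whole line, which nevertheless has an
    intersection divisor.\<close>
  have GJ: "(G, J) \<noteq> (0, 0)"
  proof
    assume "(G, J) = (0, 0)"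
    then have 0: "G = 0" "H = 0" "K = 0"
      using K by (auto simp: J_def)
    obtain C l where l: "line_divisor a b l {#proj (p, q, 1), proj (X, Y, Z), C#}"
      using coll_exists[OF in_E] unfolding coll_def by auto
    have "lin l (p, q, 1) = 0" "lin l (p * u, q * v, 0) = 0"
      using l by (auto simp: line_divisor_def intro!: lP)
    then have "huff_along a b (p, q, 1) (p * u, q * v, 0) \<noteq> 0"
      using l e unfolding line_divisor_def by blast
    moreover have "huff_along a b (p, q, 1) (p * u, q * v, 0) = huff_form [:a:] [:b:]
        (smult p [:1, 0:] + smult (p * u) [:0, 1:], smult q [:1, 0:] + smult (q * v) [:0, 1:],
         smult 1 [:1, 0:] + smult 0 [:0, 1:])"
      by (simp add: huff_along_def)
    ultimately show False
      unfolding huff_form_combination c30 c21 c12 c03 0 by simp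
  qed
  have l: "?l \<noteq> (0, 0, 0)" "lin ?l (p, q, 1) = 0" "lin ?l (p * u, q * v, 0) = 0"
    using pq uv by (auto simp: lin_def field_simps)
  have "line_divisor a b ?l
     {#proj (1 * p - 0 * (p * u), 1 * q - 0 * (q * v), 1 * 1 - 0 * 0),
       proj (- Z * p - 1 * (p * u), - Z * q - 1 * (q * v), - Z * 1 - 1 * 0),
       proj (J * p - G * (p * u), J * q - G * (q * v), J * 1 - G * 0)#}"
    using GJ K by (intro line_divisor_of_factors l e) (simp_all add: c30 c21 c12 c03 J_def)
  moreover have "proj (- Z * p - 1 * (p * u), - Z * q - 1 * (q * v), - Z * 1 - 1 * 0) = proj (X, Y, Z)"
    using proj_scale[of "- 1" X Y Z] by (simp add: X Y add.commute)
  moreover have S: "(J * p - G * (p * u), J * q - G * (q * v), J * 1 - G * 0)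
      = (- 1 * (p * (G * u - J)), - 1 * (q * (G * v - J)), - 1 * - J)"
    by (simp add: algebra_simps)
  ultimately have div: "line_divisor a b ?l
      {#proj (p, q, 1), proj (X, Y, Z), proj (p * (G * u - J), q * (G * v - J), - J)#}"
    using proj_scale[of "- 1" "p * (G * u - J)" "q * (G * v - J)" "- J"] by (simp only: S) simp
  show nz: "(p * (G * u - J), q * (G * v - J), J) \<noteq> (0, 0, 0)"
    using GJ uv pq by auto
  have "huff_form a b (p * (G * u - J), q * (G * v - J), - J) =
      - (J ^ 3) * 0 + J\<^sup>2 * G * G - J * G\<^sup>2 * H + G ^ 3 * K"
    using combination[of "- J" p G "p * u" q "q * v" 1 0]
    by (simp add: c30 c21 c12 c03 algebra_simps)
  also have "\<dots> = 0"
    unfolding K J_def by (simp add: algebra_simps power2_eq_square power3_eq_cube)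
  finally have form': "huff_form a b (p * (G * u - J), q * (G * v - J), - J) = 0" .
  then show "huff_form a b (p * (G * u - J), q * (G * v - J), J) = 0"
    by (simp add: huff_form_def)
  have nz': "(p * (G * u - J), q * (G * v - J), - J) \<noteq> (0, 0, 0)"
    using nz by auto
  have coll: "coll (proj (X, Y, Z)) (proj (p, q, 1)) (proj (p * (G * u - J), q * (G * v - J), - J))"
    using collI[OF in_E huff_pointsI[OF nz' form'] l(1) div] by (rule coll_swap)
  show "huff_add a b (proj (X, Y, Z)) (proj (p, q, 1)) = proj (p * (G * u - J), q * (G * v - J), J)"
    using neg_proj[OF nz' form'] by (simp add: huff_add_eq third_point_eq[OF coll])
  show "line_through a b (proj (X, Y, Z)) (proj (p, q, 1)) ?l"
    by (rule line_through_of_line_divisor[OF _ l(1) in_E(2,1)])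
      (use div in \<open>simp add: add_mset_commute[of "proj (p, q, 1)"]\<close>)
qed


text \<open>
  Were the denominator zero, then \<open>y \<in> K\<close>, and \<open>(Z / X)\<^sup>2 = w\<^sup>2\<close> since both are
  \<open>y (a y - b) / (1 - y)\<close>; so \<open>Q\<close> would be \<open>K\<close>-rational.
\<close>

lemma vertical_value_nonzero:
  assumes K: "is_subfield K" "X \<in> K" "Y \<in> K" "Z \<in> K"
    and S: "(X, Y, Z) \<noteq> (0, 0, 0)" "huff_form a b (X, Y, Z) = 0"
    and Q: "proj (1, y, w) \<in> E" "proj (1, y, w) \<notin> huff_points K a b"
  obtains A B where "A \<in> K" "B \<in> K" "A + B * y \<noteq> 0"
    "line_through a b (proj (X, Y, Z)) huff_O (A, B, 0)"
proof -
  have form_Q: "huff_form a b (1, y, w) = 0"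
    using Q(1) unfolding proj_in_E_iff by blast
  have w: "w\<^sup>2 * (1 - y) = y * (a * y - b)"
    using form_Q by (simp add: huff_form_def algebra_simps power2_eq_square)
  then have y1: "y \<noteq> 1"
    using ab_nz by auto
  show thesis
  proof (cases "X = 0 \<and> Y = 0")
    case True
    have "proj (X, Y, Z) = huff_O"
      using True S(1) proj_scale[of Z 0 0 1] by (simp add: huff_O_def)
    moreover have "line_through a b huff_O huff_O (- 1, 1, 0)"
      unfolding huff_O_def line_through_tangent by (simp add: huff_grad_def proj_refl)
    moreover have "- 1 \<in> K" "1 \<in> K"
      by (intro subfield_closed[OF K(1)])+
    ultimately show thesis
      using that[of "- 1" 1] y1 by simp
  next
    case False
    have neq: "proj (X, Y, Z) \<noteq> huff_O"
      using False by (auto simp: huff_O_def elim!: proj_eqD)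
    have "line_through a b (proj (X, Y, Z)) huff_O (Y, - X, 0)"
      using False neq unfolding line_through_def huff_O_def by (auto simp: on_line_proj lin_def)
    moreover have "- X \<in> K"
      by (intro subfield_closed[OF K(1)] K)
    moreover have "Y + - X * y \<noteq> 0"
    proof
      assume *: "Y + - X * y = 0"
      then have X: "X \<noteq> 0" and y: "y = Y / X"
        using False by (auto simp: field_simps)
      have "Y = X * y"
        using * by simp
      then have "X ^ 3 * (y * (a * y - b)) = X * Z\<^sup>2 * (1 - y)"
        using S(2) by (simp add: huff_form_def algebra_simps power2_eq_square power3_eq_cube)
      then have "X ^ 3 * (w\<^sup>2 * (1 - y)) = X * Z\<^sup>2 * (1 - y)"
        by (simp only: w)
      then have "X * (1 - y) * (X * w)\<^sup>2 = X * (1 - y) * Z\<^sup>2"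
        by (simp add: power2_eq_square power3_eq_cube algebra_simps)
      then have "(X * w)\<^sup>2 = Z\<^sup>2"
        using X y1 by simp
      then have "X * w = Z \<or> X * w = - Z"
        by (simp only: power2_eq_iff)
      then have "w = Z / X \<or> w = - Z / X"
        using X by (simp only: eq_divide_eq mult.commute not_False_eq_True if_True)
      moreover have "Y / X \<in> K" "Z / X \<in> K" "- Z / X \<in> K"
        by (intro subfield_closed[OF K(1)] K)+
      ultimately have "y \<in> K" "w \<in> K"
        by (auto simp: y)
      moreover have "1 \<in> K"
        by (rule subfield_closed[OF K(1)])
      ultimately have "proj (1, y, w) \<in> huff_points K a b"
        using form_Q unfolding huff_points_def by fastforce
      with Q(2) show False ..
    qed
    ultimately show thesis
      using that K(3) by blast
  qed
qed

text \<open>The program computes the numerator of \<open>g\<close> exactly; a factor in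
  \<open>Fh\<close> absorbs the missing division.\<close>

lemma addition_step:
  assumes sub: "is_subfield Fq" "is_subfield Fh" "Fq \<subseteq> Fh" and ab_Fq: "a \<in> Fq" "b \<in> Fq"
    and P: "XP \<in> Fq" "YP \<in> Fq" "ZP \<in> Fq" "P = proj (XP, YP, ZP)" "P \<in> huff_points Fq a b"
      "has_order a b P r" "2 < r"
    and Q: "yQ \<in> Fh" "zQ \<in> Fh" "Q = proj (1, yQ, zQ * \<alpha>)" "Q \<in> E" "Q \<notin> huff_points Fq a b"
  shows "\<exists>pre :: 'f list.
    list_all2 (\<lambda>v s. v \<in> kind_set Fq Fh \<alpha> s) pre addition_kinds \<and>
    (\<forall>i R f XR YR ZR.
      miller_doubled Fq Fh a b r P Q i R f \<and> bit r i \<and>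
      XR \<in> Fq \<and> YR \<in> Fq \<and> ZR \<in> Fq \<and> R = proj (XR, YR, ZR)
      \<longrightarrow>
      (let out = exec a b ([XR, YR, ZR, f] @ pre) addition_prog in
        huff_add a b R P = proj (out ! 33, out ! 36, out ! 30) \<and>
        out ! 33 \<in> Fq \<and> out ! 36 \<in> Fq \<and> out ! 30 \<in> Fq \<and>
        (\<exists>u\<in>Fh - {0}. \<exists>w\<in>g_values Fq a b R P Q. out ! 42 = u * (f * w))))"
proof -
  note Fq = subfield_closed[OF sub(1)] and Fh = subfield_closed[OF sub(2)]
  have PE: "P \<in> E"
    using P(5) unfolding huff_points_def by blast
  note coords = order_gt_2_coordinates[OF P(4) PE P(6,7)]
  define p q where "p = XP / ZP" "q = YP / ZP"
  have pq: "p \<noteq> 0" "q \<noteq> 0" "p \<in> Fq" "q \<in> Fq"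
    using coords P Fq by (auto simp: p_q_def)
  have Pq: "P = proj (p, q, 1)"
    using proj_scale[OF coords(3), of p q 1] coords by (simp add: P(4) p_q_def)
  have form_P: "huff_form a b (p, q, 1) = 0"
    using PE unfolding Pq proj_in_E_iff by blast
  \<comment> \<open>Scalings for \<open>u\<close> and \<open>v\<close>, coefficients of
    \<open>G\<close> and \<open>H\<close>, the point \<open>P\<close>, and line coefficients times
    coordinates of \<open>Q\<close>. Writing \<open>1 + 1\<close> suits the closure rules.\<close>
  define pre where "pre = [1 / p, 1 / q, - q * (b * p\<^sup>2 + 1), p * (a * q\<^sup>2 + 1),
    p * q * (a * q), (1 + 1) * (p * q * (a * q - b * p)), - (p * q * (b * p)), p, q,
    - (p / q) * yQ, p * zQ * \<alpha>]"
  have in_Fq: "1 / p \<in> Fq" "1 / q \<in> Fq" "- q * (b * p\<^sup>2 + 1) \<in> Fq" "p * (a * q\<^sup>2 + 1) \<in> Fq"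
    "p * q * (a * q) \<in> Fq" "(1 + 1) * (p * q * (a * q - b * p)) \<in> Fq" "- (p * q * (b * p)) \<in> Fq"
    "- (p / q) \<in> Fq"
    by (intro Fq pq ab_Fq)+
  then have in_Fh: "- (p / q) * yQ \<in> Fh" "p * zQ \<in> Fh"
    using in_Fq(8) pq(3) Q(1,2) sub(3) Fh(3) by (meson subsetD)+
  have kinds: "list_all2 (\<lambda>v s. v \<in> kind_set Fq Fh \<alpha> s) pre addition_kinds"
    using in_Fq in_Fh pq by (auto simp: pre_def addition_kinds_def)
  have "let out = exec a b ([X, Y, Z, f] @ pre) addition_prog in
        huff_add a b R P = proj (out ! 33, out ! 36, out ! 30) \<and>
        out ! 33 \<in> Fq \<and> out ! 36 \<in> Fq \<and> out ! 30 \<in> Fq \<and>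
        (\<exists>u\<in>Fh - {0}. \<exists>w\<in>g_values Fq a b R P Q. out ! 42 = u * (f * w))"
    if R: "miller_doubled Fq Fh a b r P Q i R f" "bit r i" "X \<in> Fq" "Y \<in> Fq" "Z \<in> Fq" "R = proj (X, Y, Z)"
    for i R f X Y Z
  proof -
    have "R \<in> E"
      using miller_points(2)[OF PE R(1)] PE by simp
    then have R': "(X, Y, Z) \<noteq> (0, 0, 0)" "huff_form a b (X, Y, Z) = 0"
      unfolding R(6) proj_in_E_iff by blast+
    have "R \<noteq> P"
      using miller_doubled_neq[OF PE P(6) _ R(1,2)] P(7) by simp
    then have RP: "proj (X, Y, Z) \<noteq> proj (p, q, 1)"
      using R(6) Pq by simp
    define u v where "u = X / p - Z" "v = Y / q - Z"
    define G where "G = p * (a * q\<^sup>2 + 1) * v - q * (b * p\<^sup>2 + 1) * u"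
    define H where "H = p * q * (a * q * v\<^sup>2 + 2 * (a * q - b * p) * u * v - b * p * u\<^sup>2)"
    define J where "J = H + G * Z"
    note formula = addition_formula[OF pq(1,2) form_P R' RP, folded u_v_def, folded G_def H_def, folded J_def]
    define out where "out = exec a b ([X, Y, Z, f] @ pre) addition_prog"
    have uv: "X * (1 / p) - Z = u" "Y * (1 / q) - Z = v"
      by (simp_all add: u_v_def)
    have G: "- q * (b * p\<^sup>2 + 1) * u + p * (a * q\<^sup>2 + 1) * v = G"
      by (simp add: G_def)
    have J: "(p * q * (a * q) * v + (1 + 1) * (p * q * (a * q - b * p)) * u) * v +
        - (p * q * (b * p)) * u * u + G * Z = J"
      by (simp add: J_def H_def algebra_simps power2_eq_square)
    have out: "out ! 33 = p * (G * u - J)" "out ! 36 = q * (G * v - J)" "out ! 30 = J"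
      "out ! 42 = f * (- (p / q) * yQ * u + v + p * zQ * \<alpha> * (u - v))"
      unfolding out_def pre_def exec_addition_prog uv G J by (simp_all add: mult.commute)
    have uv_Fq: "u \<in> Fq" "v \<in> Fq"
      unfolding u_v_def by (intro Fq pq R)+
    have "G \<in> Fq"
      unfolding G_def by (intro Fq pq ab_Fq uv_Fq)
    have "J \<in> Fq"
      unfolding J[symmetric] by (intro Fq pq ab_Fq uv_Fq \<open>G \<in> Fq\<close> R(5))
    have out_Fq: "out ! 33 \<in> Fq" "out ! 36 \<in> Fq" "out ! 30 \<in> Fq"
      unfolding out by (intro Fq pq uv_Fq \<open>G \<in> Fq\<close> \<open>J \<in> Fq\<close>)+
    have add: "huff_add a b R P = proj (out ! 33, out ! 36, out ! 30)"
      unfolding out R(6) Pq by (fact formula(1))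
    \<comment> \<open>The line through \<open>R + P\<close> and \<open>O\<close> has no
      \<open>Z\<close> term, so its value at \<open>Q\<close> lies in \<open>Fh\<close>.\<close>
    obtain A B where AB: "A \<in> Fq" "B \<in> Fq" "A + B * yQ \<noteq> 0"
        "line_through a b (huff_add a b R P) huff_O (A, B, 0)"
      using vertical_value_nonzero[OF sub(1) out_Fq _ _ Q(4,5)[unfolded Q(3)]] formula(3,4)
      unfolding add out by blast
    have "A + B * yQ \<in> l_values Fq a b (huff_add a b R P) huff_O Q"
      unfolding l_values_def Q(3) using AB Fq(7) proj_refl[of "(1, yQ, zQ * \<alpha>)"]
      by (intro CollectI exI[of _ "(A, B, 0)"] exI[of _ "(1, yQ, zQ * \<alpha>)"]) (auto simp: lin_def)
    moreover define L where "L = - (p / q) * yQ * u + v + p * zQ * \<alpha> * (u - v)"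
    have "L \<in> l_values Fq a b R P Q"
      unfolding l_values_def Q(3)
    proof (intro CollectI exI conjI)
      show "line_through a b R P (v, - (p / q) * u, p * (u - v))"
        unfolding R(6) Pq by (fact formula(2))
      show "(v, - (p / q) * u, p * (u - v)) \<in> Fq \<times> Fq \<times> Fq"
        by (intro SigmaI Fq pq uv_Fq)
      show "L = lin (v, - (p / q) * u, p * (u - v)) (1, yQ, zQ * \<alpha>) / fst (1, yQ, zQ * \<alpha>)"
        by (simp add: L_def lin_def algebra_simps)
    qed (rule proj_refl)
    ultimately have "L / (A + B * yQ) \<in> g_values Fq a b R P Q"
      unfolding g_values_def by blast
    moreover have "A + B * yQ \<in> Fh - {0}"
      using AB sub(3) Q(1) by (auto intro!: Fh(1,3))
    moreover have "out ! 42 = (A + B * yQ) * (f * (L / (A + B * yQ)))"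
      using AB(3) by (simp add: out L_def)
    ultimately have "\<exists>u\<in>Fh - {0}. \<exists>w\<in>g_values Fq a b R P Q. out ! 42 = u * (f * w)"
      by blast
    with add out_Fq show ?thesis
      unfolding Let_def out_def by blast
  qed
  with kinds show ?thesis
    by blast
qed

end

theorem mainTheorem1:
  fixes Fq Fh :: "'f::{field,finite} set" and k :: nat
  assumes "is_subfield Fq" and "is_subfield Fh" and "Fq \<subseteq> Fh"
    and "card (UNIV :: 'f set) = card Fq ^ k" and "card Fh = card Fq ^ (k div 2)"
    and "even k"
    and "CHAR('f) \<noteq> 2"
  shows "\<exists>(prog :: instr list) (pre_kinds :: kind list) iX iY iZ iF.
    prog_ok ([Base, Base, Base, Full] @ pre_kinds) prog \<and>
    {iX, iY, iZ, iF} \<subseteq> {..<4 + length pre_kinds + length prog} \<and>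
    prog_cost k ([Base, Base, Base, Full] @ pre_kinds) prog \<le> (1, k + 15, 2) \<and>
    (\<forall>a\<in>Fq. \<forall>b\<in>Fq. \<forall>(r::nat) \<alpha> P XP YP ZP Q yQ zQ.
      a * b * (a - b) \<noteq> 0 \<and>
      prime r \<and> r > 5 \<and> r \<noteq> CHAR('f) \<and>
      r dvd card (huff_points Fq a b) \<and>
      is_embedding_degree (card Fq) r k \<and>
      quadratic_generator Fh \<alpha> \<and>
      XP \<in> Fq \<and> YP \<in> Fq \<and> ZP \<in> Fq \<and> P = proj (XP, YP, ZP) \<and>
      P \<in> huff_points Fq a b \<and> has_order a b P r \<and>
      yQ \<in> Fh \<and> zQ \<in> Fh \<and> Q = proj (1, yQ, zQ * \<alpha>) \<and>
      Q \<in> huff_points UNIV a b \<and> huff_smult a b r Q = huff_O \<and>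
      Q \<notin> huff_points Fq a b
      \<longrightarrow>
      (\<exists>pre :: 'f list.
        list_all2 (\<lambda>v s. v \<in> kind_set Fq Fh \<alpha> s) pre pre_kinds \<and>
        (\<forall>i R f XR YR ZR.
          miller_doubled Fq Fh a b r P Q i R f \<and> bit r i \<and>
          XR \<in> Fq \<and> YR \<in> Fq \<and> ZR \<in> Fq \<and> R = proj (XR, YR, ZR)
          \<longrightarrow>
          (let out = exec a b ([XR, YR, ZR, f] @ pre) prog in
            huff_add a b R P = proj (out ! iX, out ! iY, out ! iZ) \<and>
            out ! iX \<in> Fq \<and> out ! iY \<in> Fq \<and> out ! iZ \<in> Fq \<and>
            (\<exists>u\<in>Fh - {0}. \<exists>w\<in>g_values Fq a b R P Q. out ! iF = u * (f * w))))))"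
proof -
  have two: "(2::'f) \<noteq> 0"
  proof
    assume "(2::'f) = 0"
    then have "CHAR('f) dvd 2"
      using of_nat_eq_0_iff_char_dvd[of 2, where 'a = 'f] by simp
    moreover have "CHAR('f) \<noteq> 1"
      using of_nat_CHAR[where 'a = 'f] by auto
    ultimately show False
      using assms(7) prime_nat_iff two_is_prime_nat by blast
  qed
  show ?thesis
  \<comment> \<open>Registers 33, 36 and 30 hold the coordinates of \<open>R + P\<close>, register
    42 the new value of \<open>f\<close>.\<close>
  proof (rule exI[of _ addition_prog], rule exI[of _ addition_kinds], rule exI[of _ 33], rule exI[of _ 36],
      rule exI[of _ 30], rule exI[of _ 42], intro conjI ballI allI impI, goal_cases)
    case 1
    show ?case
      by (rule addition_prog_ok)
  next
    case 2
    show ?case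
      by (simp add: addition_kinds_def addition_prog_def)
  next
    case 3
    show ?case
      unfolding addition_prog_cost[OF assms(6)] by simp
  next
    case (4 a b r \<alpha> P XP YP ZP Q yQ zQ)
    interpret huff_curve a b
      using 4 two by unfold_locales auto
    show ?case
      using 4 by (intro addition_step[OF assms(1-3)]) auto
  qed
qed

end
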